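(* Let $k$ be a complete valuation field such that $|k|$ is dense in $\mathbb{R}_{\geq 0}$, and let $\kappa$ be either an infinite cardinal or the class $\mathrm{Ord}$, satisfying the non-measurability condition. Let $\lambda$ be an infinite cardinal with $\lambda\in\kappa$. For each $(t,n)\in\{0,1\}\times\mathbb{Z}_{\geq 0}$ define a Banach $k$-vector space $V_{t,n}$ recursively by $V_{t,0}=k$ and, for $n>0$, $$V_{0,n}=\ell^{\infty}(\lambda,V_{1,n-1}),\qquad V_{1,n}=\mathrm{C}_0(\lambda,V_{0,n-1}).$$ Then for any $(t,n),(t',n')\in\{0,1\}\times\mathbb{Z}_{>0}$, the following are equivalent: (1) $V_{t,n}\cong V_{t',n'}$; (2) $(t,n)=(t',n')$.
   Context: A complete valuation field is a field $k$ with a complete non-Archimedean absolute value $|\cdot|\colon k\to\mathbb{R}_{\geq 0}$; $|k|$ denotes its image. Banach $k$-vector spaces are non-Archimedean (ultrametric norm); $\cong$ means isometric $k$-linear isomorphism. For a set $I$ and a Banach $k$-vector space $V$, $\ell^{\infty}(I,V)$ is the space of bounded maps $I\to V$ with the supremum norm, and $\mathrm{C}_0(I,V)$ is its closed subspace of maps $w$ such that $\{i\in I:\|w(i)\|\geq\epsilon\}$ is finite for every $\epsilon>0$. A set $X$ is $\omega_1$-measurable if it is uncountable and admits a non-principal ultrafilter closed under countable intersections; $\kappa$ satisfies the non-measurability condition if no $\alpha\in\kappa$ is $\omega_1$-measurable. *)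

theory Defs
  imports "HOL-Analysis.Analysis"
begin

section \<open>Complete valuation fields\<close>

locale complete_valuation_field =
  fixes v :: "'k::field \<Rightarrow> real"
  assumes nonneg: "v x \<ge> 0"
    and eq_zero_iff: "v x = 0 \<longleftrightarrow> x = 0"
    and mult: "v (x * y) = v x * v y"
    and ultrametric: "v (x + y) \<le> max (v x) (v y)"
    and complete: "Metric_space.mcomplete UNIV (\<lambda>x y. v (x - y))"


section \<open>Normed spaces with explicit carriers\<close>

record ('k, 'v) normed_space =
  carrier :: "'v set"
  add :: "'v \<Rightarrow> 'v \<Rightarrow> 'v"
  zero :: 'v
  scale :: "'k \<Rightarrow> 'v \<Rightarrow> 'v"
  nrm :: "'v \<Rightarrow> real"

definition isometric_linear_iso ::
  "('k, 'v) normed_space \<Rightarrow> ('k, 'w) normed_space \<Rightarrow> ('v \<Rightarrow> 'w) \<Rightarrow> bool" where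
  "isometric_linear_iso V W f \<longleftrightarrow>
     bij_betw f (carrier V) (carrier W) \<and>
     (\<forall>x\<in>carrier V. \<forall>y\<in>carrier V. f (add V x y) = add W (f x) (f y)) \<and>
     (\<forall>a. \<forall>x\<in>carrier V. f (scale V a x) = scale W a (f x)) \<and>
     (\<forall>x\<in>carrier V. nrm W (f x) = nrm V x)"

definition isometrically_isomorphic ::
  "('k, 'v) normed_space \<Rightarrow> ('k, 'w) normed_space \<Rightarrow> bool" (infix "\<cong>\<^sub>B" 50) where
  "V \<cong>\<^sub>B W \<longleftrightarrow> (\<exists>f. isometric_linear_iso V W f)"

definition scalar_space :: "('k::field \<Rightarrow> real) \<Rightarrow> ('k, 'k) normed_space" where
  "scalar_space v = \<lparr>carrier = UNIV, add = (+), zero = 0, scale = (*), nrm = v\<rparr>"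

text \<open>Maps on a subset \<open>I\<close> of a type are represented by extensional functions, that is, functions
  that take the value \<open>undefined\<close> outside \<open>I\<close>.  The norm is the intended one for \<open>I \<noteq> {}\<close>.\<close>

definition ell_inf :: "'i set \<Rightarrow> ('k, 'v) normed_space \<Rightarrow> ('k, 'i \<Rightarrow> 'v) normed_space" where
  "ell_inf I V =
     \<lparr>carrier = {w \<in> I \<rightarrow>\<^sub>E carrier V. bdd_above ((\<lambda>i. nrm V (w i)) ` I)},
      add = (\<lambda>w w'. \<lambda>i\<in>I. add V (w i) (w' i)),
      zero = (\<lambda>i\<in>I. zero V),
      scale = (\<lambda>a w. \<lambda>i\<in>I. scale V a (w i)),
      nrm = (\<lambda>w. SUP i\<in>I. nrm V (w i))\<rparr>"

definition c_zero :: "'i set \<Rightarrow> ('k, 'v) normed_space \<Rightarrow> ('k, 'i \<Rightarrow> 'v) normed_space" where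
  "c_zero I V =
     (ell_inf I V)\<lparr>carrier :=
        {w \<in> carrier (ell_inf I V). \<forall>\<epsilon>>0. finite {i\<in>I. nrm V (w i) \<ge> \<epsilon>}}\<rparr>"


section \<open>The spaces $V_{t,n}$\<close>

text \<open>The underlying sets of \<open>k\<close>, \<open>I \<rightarrow> k\<close>, \<open>I \<rightarrow> I \<rightarrow> k\<close>, \dots\ live in different types.  To define
  a sequence of spaces by recursion, they are all placed in one type of iterated families;
  each space is carried over along an injective constructor of that type.\<close>

datatype ('k, 'i) iterated_family =
    Scalar 'k
  | Family "'i \<Rightarrow> ('k, 'i) iterated_family"

definition transport :: "('v \<Rightarrow> 'w) \<Rightarrow> ('k, 'v) normed_space \<Rightarrow> ('k, 'w) normed_space" where
  "transport f V =
     \<lparr>carrier = f ` carrier V,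
      add = (\<lambda>x y. f (add V (inv f x) (inv f y))),
      zero = f (zero V),
      scale = (\<lambda>a x. f (scale V a (inv f x))),
      nrm = (\<lambda>x. nrm V (inv f x))\<rparr>"

lemma transport_iso:
  assumes "inj f"
  shows "isometric_linear_iso V (transport f V) f"
  using assms
  by (auto simp: isometric_linear_iso_def transport_def bij_betw_def inj_on_def)

text \<open>The index \<open>t\<close> is meant to range over \<open>{0, 1}\<close>.\<close>

primrec V_space ::
  "('k::field \<Rightarrow> real) \<Rightarrow> 'i set \<Rightarrow> nat \<Rightarrow> nat \<Rightarrow> ('k, ('k, 'i) iterated_family) normed_space"
where
  "V_space v I t 0 = transport Scalar (scalar_space v)"
| "V_space v I t (Suc n) =
     (if t = 0 then transport Family (ell_inf I (V_space v I 1 n))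
      else transport Family (c_zero I (V_space v I 0 n)))"

lemma V_space_0: "scalar_space v \<cong>\<^sub>B V_space v I t 0"
  unfolding isometrically_isomorphic_def
  by (auto intro!: exI[of _ Scalar] transport_iso simp: inj_def)

lemma V_space_0_Suc: "ell_inf I (V_space v I 1 n) \<cong>\<^sub>B V_space v I 0 (Suc n)"
  unfolding isometrically_isomorphic_def
  by (auto intro!: exI[of _ Family] transport_iso simp: inj_def)

lemma V_space_1_Suc: "c_zero I (V_space v I 0 n) \<cong>\<^sub>B V_space v I 1 (Suc n)"
  unfolding isometrically_isomorphic_def
  by (auto intro!: exI[of _ Family] transport_iso simp: inj_def)


section \<open>The non-measurability condition\<close>

definition ultrafilter_on :: "'a set \<Rightarrow> 'a set set \<Rightarrow> bool" where
  "ultrafilter_on X U \<longleftrightarrow>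
     U \<subseteq> Pow X \<and> X \<in> U \<and> {} \<notin> U \<and>
     (\<forall>A\<in>U. \<forall>B. A \<subseteq> B \<and> B \<subseteq> X \<longrightarrow> B \<in> U) \<and>
     (\<forall>A\<in>U. \<forall>B\<in>U. A \<inter> B \<in> U) \<and>
     (\<forall>A. A \<subseteq> X \<longrightarrow> A \<in> U \<or> X - A \<in> U)"

definition principal_on :: "'a set \<Rightarrow> 'a set set \<Rightarrow> bool" where
  "principal_on X U \<longleftrightarrow> (\<exists>x\<in>X. U = {A. A \<subseteq> X \<and> x \<in> A})"

definition omega1_measurable :: "'a set \<Rightarrow> bool" where
  "omega1_measurable X \<longleftrightarrow>
     uncountable X \<and>
     (\<exists>U. ultrafilter_on X U \<and> \<not> principal_on X U \<and>
          (\<forall>\<A>. \<A> \<subseteq> U \<and> \<A> \<noteq> {} \<and> countable \<A> \<longrightarrow> \<Inter>\<A> \<in> U))"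

text \<open>Ordinals are well-orders on subsets of a type \<open>'i\<close>, up to isomorphism; cardinals are the
  initial ones (\<^const>\<open>Card_order\<close>), and membership of an ordinal in a cardinal is
  \<^const>\<open>ordLess\<close>.  Every member of a cardinal on \<open>'i\<close> is isomorphic to an initial segment of it,
  so no member is lost by staying in one type.  The proper class \<open>Ord\<close> is represented by all
  well-orders on subsets of \<open>'i\<close>, so that non-measurability of \<open>Ord\<close> is demanded only for these;
  this is weaker, as a hypothesis, than non-measurability of all ordinals.\<close>

datatype 'i cardinal_or_Ord = Cardinal "'i rel" | Ord

fun is_infinite_cardinal_or_Ord :: "'i cardinal_or_Ord \<Rightarrow> bool" where
  "is_infinite_cardinal_or_Ord (Cardinal \<kappa>) \<longleftrightarrow> Card_order \<kappa> \<and> infinite (Field \<kappa>)"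
| "is_infinite_cardinal_or_Ord Ord \<longleftrightarrow> True"

fun ordinal_in :: "'i rel \<Rightarrow> 'i cardinal_or_Ord \<Rightarrow> bool" where
  "ordinal_in \<alpha> (Cardinal \<kappa>) \<longleftrightarrow> Well_order \<alpha> \<and> (\<alpha>, \<kappa>) \<in> ordLess"
| "ordinal_in \<alpha> Ord \<longleftrightarrow> Well_order \<alpha>"

definition nonmeasurability_condition :: "'i cardinal_or_Ord \<Rightarrow> bool" where
  "nonmeasurability_condition \<kappa> \<longleftrightarrow> (\<forall>\<alpha>. ordinal_in \<alpha> \<kappa> \<longrightarrow> \<not> omega1_measurable (Field \<alpha>))"

end

theory Submission
  imports Defs "HOL-Library.Function_Algebras"
begin

text \<open>
  Write \<open>\<ell>(S)\<close> and \<open>C(S)\<close> for the bounded families in \<open>S\<close> and for the families that tend to zero.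
  The obstruction to an isomorphism is carried by the following notion: \<open>S\<close> nearly factors through
  \<open>M\<close> if the identity of \<open>S\<close> is, up to an error of operator norm at most some \<open>q < 1\<close>, a finite sum
  of composites of contractions \<open>S \<rightarrow> M \<rightarrow> S\<close>.  This holds if \<open>S\<close> is isometrically isomorphic to
  \<open>M\<close>, or just to a retract of \<open>M\<close>.  The core of the proof is that \<open>V\<^sub>t\<^sub>,\<^sub>n'\<close> does not nearly factor
  through \<open>V\<^sub>t\<^sub>'\<^sub>,\<^sub>n\<close> when \<open>t \<noteq> t'\<close> and \<open>0 < n \<le> n'\<close> (\<open>V_fam_not_nearly_factors\<close>).

  The main tool (\<open>ex_finite_negligible_complement\<close>) is an analogue of a lemma of Chase on
  homomorphisms from products to direct sums of abelian groups.  For every contraction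
  \<open>f: \<ell>(S) \<rightarrow> C(W)\<close> there are finite index sets \<open>F\<close> and \<open>G\<close> and a \<open>q < 1\<close> such that, for \<open>x\<close>
  supported off \<open>F\<close>, the coordinates of \<open>f x\<close> off \<open>G\<close> have norm at most \<open>q\<close> times that of \<open>x\<close>.  It
  rests on a gliding hump argument, which needs humps whose norms strictly decrease to a positive
  limit and therefore a dense value group (\<open>some_tail_negligible\<close>), and on the absence of
  countably complete non-principal ultrafilters on the index set (\<open>ideal_improper\<close>).

  Suppose that \<open>\<ell>(S)\<close> nearly factors through \<open>C(W)\<close>.  Up to an error below \<open>1\<close>, the maps
  \<open>\<ell>(S) \<rightarrow> C(W)\<close> involved may be replaced, off a finite set of coordinates of the source, by their
  finitely many coordinates in \<open>G\<close>, so that they pass through a finite power of \<open>W\<close>.  If \<open>C(S)\<close>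
  nearly factors through \<open>\<ell>(W)\<close>, the maps \<open>\<ell>(W) \<rightarrow> C(S)\<close> involved may be restricted to finitely
  many coordinates of \<open>\<ell>(W)\<close>, off a finite set of coordinates of the target.  In both cases, looking
  at a single coordinate outside the finite sets shows that \<open>S\<close> nearly factors through \<open>W\<close>
  (\<open>nearly_factors_descend\<close>).  This lowers both levels by one and exchanges the two kinds of
  spaces.  The descent ends when \<open>W\<close> is the field: then an operator of finite rank would be at
  distance less than \<open>1\<close> from the identity on a space of infinite dimension, although it kills a
  non-zero vector (\<open>factors_scalars_kernel\<close>).

  This separates spaces with \<open>t \<noteq> t'\<close>.  If \<open>t = t'\<close> and \<open>n < n'\<close>, each coordinate makes
  \<open>V\<^sub>1\<^sub>-\<^sub>t\<^sub>,\<^sub>n'\<^sub>-\<^sub>1\<close> a retract of \<open>V\<^sub>t\<^sub>,\<^sub>n'\<close>, so an isomorphism of \<open>V\<^sub>t\<^sub>,\<^sub>n'\<close> with \<open>V\<^sub>t\<^sub>,\<^sub>n\<close> would make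
  \<open>V\<^sub>1\<^sub>-\<^sub>t\<^sub>,\<^sub>n'\<^sub>-\<^sub>1\<close> nearly factor through \<open>V\<^sub>t\<^sub>,\<^sub>n\<close>, which is excluded because \<open>n \<le> n' - 1\<close>.

  To have all spaces in one type with pointwise addition, an iterated family is curried into a
  function from finite index sequences to the field.  All the norms then become the supremum norm
  of such functions.
\<close>

section \<open>Sup-normed spaces of functions on finite sequences\<close>

text \<open>Vectors are functions here.  Their operations must not be evaluated pointwise by default, since
  the simplifier would then rewrite a sum of vectors into a lambda-abstraction.\<close>
lemmas fam_apply = plus_fun_apply zero_fun_apply minus_apply uminus_apply

declare fam_apply [simp del]

context complete_valuation_field
begin

lemma v_zero [simp]: "v 0 = 0"
  using eq_zero_iff by simp

lemma v_one [simp]: "v 1 = 1"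
proof -
  have "v 1 * v 1 = v 1 * 1" using mult[of 1 1] by simp
  moreover have "v 1 \<noteq> 0" using eq_zero_iff by simp
  ultimately show ?thesis by simp
qed

lemma v_minus [simp]: "v (- x) = v x"
proof -
  have "v (-1) * v (-1) = 1" using mult[of "-1" "-1"] by simp
  then have "v (-1) = 1"
    using nonneg[of "-1"] by (metis abs_of_nonneg abs_square_eq_1 power2_eq_square)
  then show ?thesis using mult[of "-1" x] by simp
qed

definition bounded_fam :: "('i list \<Rightarrow> 'k) \<Rightarrow> bool" where
  "bounded_fam w \<longleftrightarrow> bdd_above (range (\<lambda>l. v (w l)))"

definition supnorm :: "('i list \<Rightarrow> 'k) \<Rightarrow> real" where
  "supnorm w = (SUP l. v (w l))"

definition smult :: "'k \<Rightarrow> ('i list \<Rightarrow> 'k) \<Rightarrow> 'i list \<Rightarrow> 'k" where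
  "smult a w = (\<lambda>l. a * w l)"

lemma bounded_famI: "(\<And>l. v (w l) \<le> c) \<Longrightarrow> bounded_fam w"
  unfolding bounded_fam_def by (rule bdd_aboveI[of _ c]) auto

lemma v_le_supnorm: "bounded_fam w \<Longrightarrow> v (w l) \<le> supnorm w"
  unfolding bounded_fam_def supnorm_def by (auto intro: cSUP_upper)

lemma supnorm_le: "(\<And>l. v (w l) \<le> c) \<Longrightarrow> supnorm w \<le> c"
  unfolding supnorm_def by (auto intro: cSUP_least)

lemma supnorm_nonneg: "bounded_fam w \<Longrightarrow> 0 \<le> supnorm w"
  using v_le_supnorm nonneg order_trans by blast

lemma supnorm_zero [simp]: "supnorm 0 = 0"
  unfolding supnorm_def by (simp add: fam_apply)

lemma bounded_zero [simp]: "bounded_fam 0"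
  by (rule bounded_famI[of _ 0]) (simp add: fam_apply)

lemma supnorm_eq_zero: "bounded_fam w \<Longrightarrow> supnorm w = 0 \<Longrightarrow> w = 0"
  using v_le_supnorm nonneg eq_zero_iff by (metis ext order_antisym zero_fun_apply)

lemma supnorm_pos: "bounded_fam w \<Longrightarrow> w \<noteq> 0 \<Longrightarrow> 0 < supnorm w"
  using supnorm_nonneg supnorm_eq_zero by force

lemma v_add_le_max_supnorm:
  assumes "bounded_fam x" "bounded_fam y"
  shows "v ((x + y) l) \<le> max (supnorm x) (supnorm y)"
  using ultrametric[of "x l" "y l"] v_le_supnorm[OF assms(1), of l] v_le_supnorm[OF assms(2), of l] by (auto simp: fam_apply)

lemma bounded_add: "bounded_fam x \<Longrightarrow> bounded_fam y \<Longrightarrow> bounded_fam (x + y)"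
  by (rule bounded_famI) (rule v_add_le_max_supnorm)

lemma supnorm_add_le: "bounded_fam x \<Longrightarrow> bounded_fam y \<Longrightarrow> supnorm (x + y) \<le> max (supnorm x) (supnorm y)"
  by (rule supnorm_le) (rule v_add_le_max_supnorm)

lemma supnorm_smult_le:
  assumes "bounded_fam x" shows "bounded_fam (smult a x)" "supnorm (smult a x) \<le> v a * supnorm x"
proof -
  have "v (smult a x l) \<le> v a * supnorm x" for l
    unfolding smult_def mult using v_le_supnorm[OF assms] nonneg by (intro mult_left_mono)
  then show "bounded_fam (smult a x)" "supnorm (smult a x) \<le> v a * supnorm x"
    by (auto intro: bounded_famI supnorm_le)
qed

lemma smult_smult: "smult a (smult b x) = smult (a * b) x"
  by (simp add: smult_def mult.assoc)

lemma smult_one [simp]: "smult 1 x = x"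
  by (simp add: smult_def)

lemma smult_zero [simp]: "smult 0 x = 0" "smult a 0 = 0"
  by (auto simp: smult_def fam_apply)

lemma smult_minus_one: "smult (-1) x = - x"
  by (auto simp: smult_def fam_apply)

lemma supnorm_smult:
  assumes "bounded_fam x" shows "supnorm (smult a x) = v a * supnorm x"
proof (cases "a = 0")
  case False
  have "supnorm x = supnorm (smult (inverse a) (smult a x))" using False by (simp add: smult_smult)
  also have "\<dots> \<le> v (inverse a) * supnorm (smult a x)" by (intro supnorm_smult_le assms)
  finally have "v a * supnorm x \<le> v a * (v (inverse a) * supnorm (smult a x))"
    using nonneg by (intro mult_left_mono)
  also have "\<dots> = supnorm (smult a x)" using mult[of a "inverse a"] False by simp
  finally show ?thesis using supnorm_smult_le[OF assms, of a] by simp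
qed simp

lemma supnorm_minus [simp]: "supnorm (- x) = supnorm x"
  by (simp add: supnorm_def fam_apply)

lemma bounded_minus [simp]: "bounded_fam (- x) \<longleftrightarrow> bounded_fam x"
  by (simp add: bounded_fam_def fam_apply)

lemma supnorm_diff_le: "bounded_fam x \<Longrightarrow> bounded_fam y \<Longrightarrow> supnorm (x - y) \<le> max (supnorm x) (supnorm y)"
  using supnorm_add_le[of x "- y"] by simp

text \<open>Boundedness is part of the notion because \<^const>\<open>supnorm\<close> is meaningful only on bounded
  functions.\<close>
definition subspace :: "('i list \<Rightarrow> 'k) set \<Rightarrow> bool" where
  "subspace S \<longleftrightarrow> (\<forall>x\<in>S. bounded_fam x) \<and> 0 \<in> S \<and>
     (\<forall>x\<in>S. \<forall>y\<in>S. x + y \<in> S) \<and> (\<forall>a. \<forall>x\<in>S. smult a x \<in> S)"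

lemma subspaceD:
  assumes "subspace S"
  shows "x \<in> S \<Longrightarrow> bounded_fam x" "0 \<in> S" "x \<in> S \<Longrightarrow> y \<in> S \<Longrightarrow> x + y \<in> S"
    "x \<in> S \<Longrightarrow> smult a x \<in> S" "x \<in> S \<Longrightarrow> - x \<in> S" "x \<in> S \<Longrightarrow> y \<in> S \<Longrightarrow> x - y \<in> S"
proof -
  show m: "x \<in> S \<Longrightarrow> - x \<in> S" for x
    using assms smult_minus_one[of x] unfolding subspace_def by metis
  show "x \<in> S \<Longrightarrow> y \<in> S \<Longrightarrow> x - y \<in> S"
    using assms m[of y] unfolding subspace_def by (metis diff_conv_add_uminus)
qed (use assms in \<open>auto simp: subspace_def\<close>)

lemma subspace_sum:
  "subspace S \<Longrightarrow> (\<And>a. a \<in> A \<Longrightarrow> g a \<in> S) \<Longrightarrow> sum g A \<in> S"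
  by (induction A rule: infinite_finite_induct) (auto simp: subspaceD)

definition contraction ::
  "('i list \<Rightarrow> 'k) set \<Rightarrow> ('i list \<Rightarrow> 'k) set \<Rightarrow> (('i list \<Rightarrow> 'k) \<Rightarrow> 'i list \<Rightarrow> 'k) \<Rightarrow> bool" where
  "contraction S S' f \<longleftrightarrow>
     (\<forall>x\<in>S. f x \<in> S' \<and> supnorm (f x) \<le> supnorm x) \<and>
     (\<forall>x\<in>S. \<forall>y\<in>S. f (x + y) = f x + f y) \<and> (\<forall>a. \<forall>x\<in>S. f (smult a x) = smult a (f x))"

lemma contractionD:
  assumes "contraction S S' f"
  shows "x \<in> S \<Longrightarrow> f x \<in> S'" "x \<in> S \<Longrightarrow> supnorm (f x) \<le> supnorm x"
    "x \<in> S \<Longrightarrow> y \<in> S \<Longrightarrow> f (x + y) = f x + f y" "x \<in> S \<Longrightarrow> f (smult a x) = smult a (f x)"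
  using assms unfolding contraction_def by auto

lemma contraction_diff:
  assumes "contraction S S' f" "subspace S" "x \<in> S" "y \<in> S"
  shows "f (x - y) = f x - f y"
proof -
  have "f (x + smult (-1) y) = f x + smult (-1) (f y)"
    using contractionD(3)[OF assms(1,3) subspaceD(4)[OF assms(2,4)]]
      contractionD(4)[OF assms(1,4)] by simp
  then show ?thesis by (simp add: smult_minus_one)
qed

lemma contraction_zero:
  assumes "contraction S S' f" "subspace S" shows "f 0 = 0"
  using contraction_diff[OF assms subspaceD(2) subspaceD(2)] assms(2) by simp

lemma contraction_mono:
  "contraction S S' f \<Longrightarrow> R \<subseteq> S \<Longrightarrow> S' \<subseteq> R' \<Longrightarrow> contraction R R' f"
  unfolding contraction_def by (auto simp: subset_iff)

lemma contraction_comp: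
  "contraction S S' f \<Longrightarrow> contraction S' S'' g \<Longrightarrow> contraction S S'' (\<lambda>x. g (f x))"
  unfolding contraction_def by (auto intro: order_trans)

section \<open>Coordinates, bounded families and null families\<close>

definition coord :: "'i \<Rightarrow> ('i list \<Rightarrow> 'k) \<Rightarrow> 'i list \<Rightarrow> 'k" where
  "coord i w = (\<lambda>l. w (i # l))"

definition single :: "'i \<Rightarrow> ('i list \<Rightarrow> 'k) \<Rightarrow> 'i list \<Rightarrow> 'k" where
  "single i w = (\<lambda>l. case l of [] \<Rightarrow> 0 | j # l' \<Rightarrow> if j = i then w l' else 0)"

definition cut :: "'i set \<Rightarrow> ('i list \<Rightarrow> 'k) \<Rightarrow> 'i list \<Rightarrow> 'k" where
  "cut A w = (\<lambda>l. case l of [] \<Rightarrow> 0 | j # l' \<Rightarrow> if j \<in> A then w l else 0)"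

text \<open>A family \<open>(w\<^sub>i)\<close> of functions on sequences is encoded as the function \<open>i # l \<mapsto> w\<^sub>i l\<close>.  The
  empty sequence carries no information, and indices outside \<open>I\<close> stand for the zero vector; fixing
  the value \<open>0\<close> in both places makes the encoding injective.\<close>
definition linf :: "'i set \<Rightarrow> ('i list \<Rightarrow> 'k) set \<Rightarrow> ('i list \<Rightarrow> 'k) set" where
  "linf I S = {w. bounded_fam w \<and> w [] = 0 \<and> (\<forall>i\<in>I. coord i w \<in> S) \<and> (\<forall>i. i \<notin> I \<longrightarrow> coord i w = 0)}"

definition c0 :: "'i set \<Rightarrow> ('i list \<Rightarrow> 'k) set \<Rightarrow> ('i list \<Rightarrow> 'k) set" where
  "c0 I S = {w \<in> linf I S. \<forall>\<epsilon>>0. finite {i\<in>I. \<epsilon> \<le> supnorm (coord i w)}}"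

lemma coord_simps [simp]:
  "coord i (x + y) = coord i x + coord i y" "coord i (x - y) = coord i x - coord i y"
  "coord i (smult a x) = smult a (coord i x)" "coord i 0 = 0"
  "coord i (single j x) = (if i = j then x else 0)"
  "coord i (cut A x) = (if i \<in> A then coord i x else 0)"
  by (auto simp: coord_def single_def cut_def smult_def fam_apply)

lemma single_simps [simp]:
  "single i (x + y) = single i x + single i y" "single i (smult a x) = smult a (single i x)"
  by (auto simp: single_def smult_def fam_apply split: list.split)

lemma cut_simps [simp]:
  "cut A (x + y) = cut A x + cut A y" "cut A (smult a x) = smult a (cut A x)" "cut {} x = 0"
  by (auto simp: cut_def smult_def fam_apply split: list.split)

lemma nil_simps [simp]: "single i x [] = 0" "cut A x [] = 0" "smult a x [] = a * x []"
  by (auto simp: single_def cut_def smult_def)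

lemma fam_eqI: "x [] = y [] \<Longrightarrow> (\<And>i. coord i x = coord i y) \<Longrightarrow> x = y"
proof
  fix l assume *: "x [] = y []" "\<And>i. coord i x = coord i y"
  show "x l = y l" using * by (cases l) (auto simp: coord_def fun_eq_iff)
qed

lemma bounded_coord: "bounded_fam w \<Longrightarrow> bounded_fam (coord i w)"
  by (rule bounded_famI[of _ "supnorm w"]) (simp add: coord_def v_le_supnorm)

lemma supnorm_coord_le: "bounded_fam w \<Longrightarrow> supnorm (coord i w) \<le> supnorm w"
  by (rule supnorm_le) (simp add: coord_def v_le_supnorm)

lemma bounded_supnorm_le_coord:
  assumes "w [] = 0" "0 \<le> c" "\<And>i. bounded_fam (coord i w)" "\<And>i. supnorm (coord i w) \<le> c"
  shows "bounded_fam w" "supnorm w \<le> c"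
proof -
  have "v (w l) \<le> c" for l
  proof (cases l)
    case (Cons i l')
    then have "v (w l) \<le> supnorm (coord i w)" using v_le_supnorm[OF assms(3), of i l'] by (simp add: coord_def)
    then show ?thesis using assms(4)[of i] by simp
  qed (use assms in simp)
  then show "bounded_fam w" "supnorm w \<le> c" by (auto intro: bounded_famI supnorm_le)
qed

lemma bounded_single:
  assumes "bounded_fam w" shows "bounded_fam (single i w)" "supnorm (single i w) \<le> supnorm w"
proof -
  have "bounded_fam (coord j (single i w))" "supnorm (coord j (single i w)) \<le> supnorm w" for j
    using assms by (simp_all add: supnorm_nonneg)
  then show "bounded_fam (single i w)" "supnorm (single i w) \<le> supnorm w"
    using bounded_supnorm_le_coord[of "single i w" "supnorm w"] supnorm_nonneg[OF assms] by simp_all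
qed

lemma bounded_cut:
  assumes "bounded_fam w" shows "bounded_fam (cut A w)" "supnorm (cut A w) \<le> supnorm w"
proof -
  have "bounded_fam (coord j (cut A w))" "supnorm (coord j (cut A w)) \<le> supnorm w" for j
    using assms by (simp_all add: supnorm_nonneg bounded_coord supnorm_coord_le)
  then show "bounded_fam (cut A w)" "supnorm (cut A w) \<le> supnorm w"
    using bounded_supnorm_le_coord[of "cut A w" "supnorm w"] supnorm_nonneg[OF assms] by simp_all
qed

lemma linfD:
  assumes "w \<in> linf I S"
  shows "bounded_fam w" "w [] = 0" "i \<in> I \<Longrightarrow> coord i w \<in> S" "i \<notin> I \<Longrightarrow> coord i w = 0"
  using assms unfolding linf_def by auto

lemma c0_subset_linf: "c0 I S \<subseteq> linf I S"
  by (auto simp: c0_def)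

lemma subspace_linf: assumes "subspace S" shows "subspace (linf I S)"
  unfolding subspace_def linf_def
  using assms by (auto simp: subspaceD bounded_add supnorm_smult_le fam_apply)

lemma subspace_c0: assumes S: "subspace S" shows "subspace (c0 I S)"
proof -
  note E = subspace_linf[OF S, of I]
  have "x + y \<in> c0 I S" if "x \<in> c0 I S" "y \<in> c0 I S" for x y
  proof -
    have b: "bounded_fam (coord i x)" "bounded_fam (coord i y)" for i
      using that by (auto simp: c0_def linf_def bounded_coord)
    have "finite {i\<in>I. \<epsilon> \<le> supnorm (coord i (x + y))}" if "0 < \<epsilon>" for \<epsilon>
    proof (rule finite_subset)
      show "{i\<in>I. \<epsilon> \<le> supnorm (coord i (x + y))} \<subseteq>
        {i\<in>I. \<epsilon> \<le> supnorm (coord i x)} \<union> {i\<in>I. \<epsilon> \<le> supnorm (coord i y)}"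
      proof
        fix i assume "i \<in> {i\<in>I. \<epsilon> \<le> supnorm (coord i (x + y))}"
        then show "i \<in> {i\<in>I. \<epsilon> \<le> supnorm (coord i x)} \<union> {i\<in>I. \<epsilon> \<le> supnorm (coord i y)}"
          using supnorm_add_le[OF b, of i i] by (auto simp: max_def split: if_splits)
      qed
    qed (use that \<open>x \<in> c0 I S\<close> \<open>y \<in> c0 I S\<close> in \<open>auto simp: c0_def\<close>)
    then show ?thesis using that subspaceD(3)[OF E] by (auto simp: c0_def)
  qed
  moreover have "smult a x \<in> c0 I S" if "x \<in> c0 I S" for a x
  proof (cases "a = 0")
    case False
    then have a: "0 < v a" using nonneg[of a] eq_zero_iff[of a] by simp
    have b: "bounded_fam (coord i x)" for i
      using that by (auto simp: c0_def linf_def bounded_coord)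
    have "finite {i\<in>I. \<epsilon> \<le> supnorm (coord i (smult a x))}" if "0 < \<epsilon>" for \<epsilon>
    proof -
      have "finite {i\<in>I. \<epsilon> / v a \<le> supnorm (coord i x)}"
        using that a \<open>x \<in> c0 I S\<close> by (auto simp: c0_def)
      then show ?thesis using a by (simp add: supnorm_smult[OF b] field_simps)
    qed
    then show ?thesis using that subspaceD(4)[OF E] by (auto simp: c0_def)
  qed (use E in \<open>auto simp: c0_def subspaceD\<close>)
  ultimately show ?thesis
    using E unfolding subspace_def by (auto simp: c0_def)
qed

lemma linf_mono_index:
  assumes "subspace S" "A \<subseteq> B" shows "linf A S \<subseteq> linf B S"
proof
  fix x assume x: "x \<in> linf A S"
  have "coord i x \<in> S" for i
    using linfD(3,4)[OF x, of i] subspaceD(2)[OF assms(1)] by (cases "i \<in> A") auto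
  then show "x \<in> linf B S" using x assms unfolding linf_def by auto
qed

lemma linf_finite_subset_c0:
  assumes "subspace S" "K \<subseteq> I" "finite K" shows "linf K S \<subseteq> c0 I S"
proof
  fix x assume x: "x \<in> linf K S"
  have "finite {i\<in>I. \<epsilon> \<le> supnorm (coord i x)}" if "\<epsilon> > 0" for \<epsilon>
  proof (rule finite_subset[OF _ assms(3)])
    show "{i\<in>I. \<epsilon> \<le> supnorm (coord i x)} \<subseteq> K"
      using linfD(4)[OF x] that by force
  qed
  then show "x \<in> c0 I S"
    using x linf_mono_index[OF assms(1,2)] by (auto simp: c0_def)
qed

lemma cut_in_linf:
  assumes "subspace S" "x \<in> linf I S" shows "cut A x \<in> linf (A \<inter> I) S"
  using assms unfolding linf_def by (auto simp: bounded_cut)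

lemma cut_in_linf': "subspace S \<Longrightarrow> x \<in> linf I S \<Longrightarrow> cut A x \<in> linf I S"
  using cut_in_linf linf_mono_index by (metis inf_le2 subsetD)

lemma contraction_coord: "subspace S \<Longrightarrow> i \<in> I \<Longrightarrow> contraction (linf I S) S (coord i)"
  unfolding contraction_def by (auto simp: linfD supnorm_coord_le)

lemma contraction_single:
  assumes "subspace S" shows "contraction S (linf {i} S) (single i)"
  using assms unfolding contraction_def linf_def
  by (auto simp: subspaceD bounded_single)

section \<open>Finite sums of maps through a space\<close>

lemma smult_eq_zero_iff [simp]: "smult a x = 0 \<longleftrightarrow> a = 0 \<or> x = 0"
  by (auto simp: smult_def fun_eq_iff fam_apply)

definition scalars :: "('i list \<Rightarrow> 'k) set" where
  "scalars = {w. \<forall>l. l \<noteq> [] \<longrightarrow> w l = 0}"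

lemma subspace_scalars: "subspace scalars"
proof -
  have "bounded_fam x" if "x \<in> scalars" for x
  proof (rule bounded_famI)
    show "v (x l) \<le> v (x [])" for l
      using that nonneg by (cases "l = []") (auto simp: scalars_def)
  qed
  then show ?thesis unfolding subspace_def by (auto simp: scalars_def smult_def fam_apply)
qed

lemma scalars_eq_zero: "w \<in> scalars \<Longrightarrow> w [] = 0 \<Longrightarrow> w = 0"
proof (rule ext)
  fix l assume "w \<in> scalars" "w [] = 0"
  then show "w l = 0 l" by (cases l) (simp_all add: scalars_def fam_apply)
qed

text \<open>These are the maps \<open>S \<rightarrow> S'\<close> that factor through a finite power of \<open>M\<close>; writing them as sums of
  composites avoids forming the power.  Contractions are only controlled on their domain, so
  the rules prescribe the values of the map on \<open>S\<close> only.\<close>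
inductive factors ::
  "('i list \<Rightarrow> 'k) set \<Rightarrow> ('i list \<Rightarrow> 'k) set \<Rightarrow> ('i list \<Rightarrow> 'k) set
     \<Rightarrow> (('i list \<Rightarrow> 'k) \<Rightarrow> 'i list \<Rightarrow> 'k) \<Rightarrow> bool"
  for S M S' where
  zero: "(\<And>x. x \<in> S \<Longrightarrow> T x = 0) \<Longrightarrow> factors S M S' T"
| step: "contraction S M i \<Longrightarrow> contraction M S' p \<Longrightarrow> factors S M S' T \<Longrightarrow>
    (\<And>x. x \<in> S \<Longrightarrow> T' x = p (i x) + T x) \<Longrightarrow> factors S M S' T'"

text \<open>By the ultrametric inequality, a sum of contractions is again a contraction.\<close>
lemma factors_contraction:
  assumes "factors S M S' T" and S: "subspace S" and S': "subspace S'"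
  shows "contraction S S' T"
  using assms(1)
proof induction
  case (zero T)
  then show ?case using S S' unfolding contraction_def by (auto simp: subspaceD supnorm_nonneg)
next
  case (step i p T T')
  note pi = contraction_comp[OF step.hyps(1,2)]
  have "supnorm (p (i x) + T x) \<le> supnorm x" if "x \<in> S" for x
    using supnorm_add_le[of "p (i x)" "T x"] contractionD(1,2)[OF pi that]
      contractionD(1,2)[OF step.IH that] S' by (simp add: subspaceD)
  moreover have "p (i x) + T x \<in> S'" if "x \<in> S" for x
    using contractionD(1)[OF pi that] contractionD(1)[OF step.IH that] S' by (simp add: subspaceD)
  moreover have "T' (x + y) = T' x + T' y" if "x \<in> S" "y \<in> S" for x y
    unfolding step.hyps(4)[OF that(1)] step.hyps(4)[OF that(2)]
      step.hyps(4)[OF subspaceD(3)[OF S that]] contractionD(3)[OF pi that] contractionD(3)[OF step.IH that]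
    by simp
  moreover have "T' (smult a x) = smult a (T' x)" if "x \<in> S" for a x
    unfolding step.hyps(4)[OF that] step.hyps(4)[OF subspaceD(4)[OF S that]]
      contractionD(4)[OF pi that] contractionD(4)[OF step.IH that]
    by (auto simp: smult_def algebra_simps fam_apply)
  ultimately show ?case
    using step.hyps(4) unfolding contraction_def by metis
qed

lemma factors_single:
  assumes "contraction S M i" "contraction M S' p"
  shows "factors S M S' (\<lambda>x. p (i x))"
  by (rule factors.step[OF assms factors.zero[of _ "\<lambda>_. 0"]]) auto

lemma factors_add:
  assumes "factors S M S' T" "factors S M S' U"
  shows "factors S M S' (\<lambda>x. T x + U x)"
  using assms(1)
proof induction
  case (zero T)
  show ?case using assms(2)
  proof cases
    case zero
    then show ?thesis
      using \<open>\<And>x. x \<in> S \<Longrightarrow> T x = 0\<close> by (intro factors.zero) simp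
  next
    case (step i p U')
    show ?thesis by (rule factors.step[OF step(1-3)]) (simp add: step zero)
  qed
next
  case (step i p T T')
  show ?case
    by (rule factors.step[OF step.hyps(1,2) step.IH]) (simp add: step.hyps(4) add.assoc)
qed

lemma factors_comp:
  assumes "factors S M S' T" "contraction R S a" "contraction S' R' b" "subspace S" "subspace S'"
  shows "factors R M R' (\<lambda>x. b (T (a x)))"
  using assms(1)
proof induction
  case (zero T)
  then show ?case
    using contraction_zero[OF assms(3,5)] contractionD(1)[OF assms(2)] by (intro factors.zero) simp
next
  case (step i p T T')
  note T = factors_contraction[OF step.hyps(3) assms(4,5)]
  show ?case
  proof (rule factors.step[OF contraction_comp[OF assms(2) step.hyps(1)]
        contraction_comp[OF step.hyps(2) assms(3)] step.IH])
    fix x assume "x \<in> R"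
    then have "a x \<in> S" using assms(2) by (simp add: contractionD)
    then show "b (T' (a x)) = b (p (i (a x))) + b (T (a x))"
      using contractionD(1)[OF T] contractionD(1)[OF contraction_comp[OF step.hyps(1,2)]]
      by (simp add: step.hyps(4)[OF \<open>a x \<in> S\<close>] contractionD(3)[OF assms(3)] \<open>a x \<in> S\<close>)
  qed
qed

text \<open>A map of finite rank kills a non-zero vector supported in any given infinite index set.  To pass
  from \<open>T\<close> to \<open>p \<circ> i + T\<close>, where \<open>i\<close> is a functional, take two vectors killed by \<open>T\<close> with disjoint
  supports.  Some combination of them is also killed by \<open>i\<close>, and it is non-zero because the
  supports are disjoint.\<close>
lemma factors_scalars_kernel:
  assumes "factors X scalars X' T" and spX: "subspace X" and X': "subspace X'" and S: "subspace S" and sub: "c0 I S \<subseteq> X"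
    and u: "u \<in> S" "u \<noteq> 0"
  shows "infinite J \<Longrightarrow> J \<subseteq> I \<Longrightarrow> \<exists>K x. finite K \<and> K \<subseteq> J \<and> x \<in> linf K S \<and> x \<noteq> 0 \<and> T x = 0"
  using assms(1)
proof (induction arbitrary: J)
  case (zero T)
  then obtain j where j: "j \<in> J" by (metis ex_in_conv finite.emptyI)
  have x: "single j u \<in> linf {j} S" using contractionD(1)[OF contraction_single[OF S] u(1)] .
  have "single j u \<noteq> 0" using u(2) by (metis coord_simps(4,5))
  moreover have "single j u \<in> X"
    using x linf_finite_subset_c0[OF S, of "{j}" I] j zero(3) sub by blast
  ultimately show ?case using x j zero by (intro exI[of _ "{j}"] exI[of _ "single j u"]) auto
next
  case (step i p T T')
  obtain K1 x1 where 1: "finite K1" "K1 \<subseteq> J" "x1 \<in> linf K1 S" "x1 \<noteq> 0" "T x1 = 0"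
    using step.IH[OF step.prems] by blast
  have "infinite (J - K1)" "J - K1 \<subseteq> I" using step.prems 1 by auto
  from step.IH[OF this] obtain K2 x2
    where 2: "finite K2" "K2 \<subseteq> J - K1" "x2 \<in> linf K2 S" "x2 \<noteq> 0" "T x2 = 0"
    by blast
  have K: "K1 \<subseteq> I" "K2 \<subseteq> I" using 1(2) 2(2) step.prems(2) by auto
  have X12: "x1 \<in> X" "x2 \<in> X"
    using subsetD[OF linf_finite_subset_c0[OF S K(1) 1(1)] 1(3)]
      subsetD[OF linf_finite_subset_c0[OF S K(2) 2(1)] 2(3)] sub by auto
  note p0 = contraction_zero[OF step.hyps(2) subspace_scalars]
  define a1 a2 where "a1 = i x1 []" and "a2 = i x2 []"
  show ?case
  proof (cases "a1 = 0")
    case True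
    then have "i x1 = 0"
      using scalars_eq_zero[OF contractionD(1)[OF step.hyps(1) X12(1)]] unfolding a1_def by simp
    then have "T' x1 = 0" using step.hyps(4)[OF X12(1)] p0 1 by simp
    then show ?thesis using 1 by blast
  next
    case False
    \<comment> \<open>the combination of \<open>x1\<close> and \<open>x2\<close> on which the functional \<open>i\<close> vanishes\<close>
    define x where "x = smult a2 x1 - smult a1 x2"
    have X: "smult a2 x1 \<in> X" "smult a1 x2 \<in> X" "x \<in> X" using X12 spX by (auto simp: subspaceD x_def)
    have ix: "i x = smult a2 (i x1) - smult a1 (i x2)"
      unfolding x_def using contraction_diff[OF step.hyps(1) spX X(1,2)] X12
        contractionD(4)[OF step.hyps(1)] by simp
    have "i x [] = 0" by (simp add: ix a1_def a2_def fam_apply)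
    then have ix0: "i x = 0" by (rule scalars_eq_zero[OF contractionD(1)[OF step.hyps(1) X(3)]])
    note T = factors_contraction[OF step.hyps(3) spX X']
    have Tx: "T x = 0"
      unfolding x_def using contraction_diff[OF T spX X(1,2)] contractionD(4)[OF T] X12 1(5) 2(5)
      by simp
    have "x \<in> linf (K1 \<union> K2) S"
      unfolding x_def using 1(3) 2(3) linf_mono_index[OF S, of K1 "K1 \<union> K2"]
        linf_mono_index[OF S, of K2 "K1 \<union> K2"] subspace_linf[OF S, of "K1 \<union> K2"]
      by (intro subspaceD) auto
    moreover have "x \<noteq> 0"
    proof
      assume "x = 0"
      obtain j where j: "coord j x2 \<noteq> 0"
        using fam_eqI[of x2 0] 2(4) linfD(2)[OF 2(3)] by (auto simp: fam_apply)
      then have "j \<in> K2" using linfD(4)[OF 2(3)] by blast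
      then have "coord j x1 = 0" using linfD(4)[OF 1(3)] 2(2) by blast
      moreover have "coord j x = 0" using \<open>x = 0\<close> by simp
      ultimately show False using j False by (simp add: x_def)
    qed
    ultimately show ?thesis
      using Tx ix0 step.hyps(4)[OF X(3)] p0 1 2
      by (intro exI[of _ "K1 \<union> K2"] exI[of _ x]) auto
  qed
qed

section \<open>The gliding hump\<close>

lemma bounded_sum: "(\<And>m. m \<in> A \<Longrightarrow> bounded_fam (g m)) \<Longrightarrow> bounded_fam (sum g A)"
  by (induction A rule: infinite_finite_induct) (auto simp: bounded_add)

lemma supnorm_sum_le:
  assumes "0 \<le> c" "\<And>m. m \<in> A \<Longrightarrow> bounded_fam (g m)" "\<And>m. m \<in> A \<Longrightarrow> supnorm (g m) \<le> c"
  shows "supnorm (sum g A) \<le> c"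
  using assms
proof (induction A rule: infinite_finite_induct)
  case (insert m A)
  then have "supnorm (g m + sum g A) \<le> max (supnorm (g m)) (supnorm (sum g A))"
    by (intro supnorm_add_le bounded_sum) auto
  moreover have "supnorm (g m) \<le> c" "supnorm (sum g A) \<le> c" using insert by auto
  ultimately show ?case using insert.hyps by simp
qed auto

lemma coord_sum [simp]: "coord i (sum g A) = (\<Sum>m\<in>A. coord i (g m))"
  by (induction A rule: infinite_finite_induct) auto

lemma contraction_sum:
  assumes "contraction S S' f" "subspace S" "\<And>m. m \<in> A \<Longrightarrow> g m \<in> S"
  shows "f (sum g A) = (\<Sum>m\<in>A. f (g m))"
  using assms(3)
proof (induction A rule: infinite_finite_induct)
  case (insert m A)
  then have "sum g A \<in> S" by (intro subspace_sum[OF assms(2)]) simp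
  with insert show ?case using contractionD(3)[OF assms(1), of "g m" "sum g A"] by simp
qed (use contraction_zero[OF assms(1,2)] in auto)

text \<open>The infinite sum of the \<open>x m\<close> with \<open>m \<in> P\<close>, when \<open>x m\<close> is supported in \<open>B m\<close> and each index lies
  in finitely many of the \<open>B m\<close>.  Such a sum is finite in each coordinate and does not have to
  converge in norm.\<close>
definition paste ::
  "(nat \<Rightarrow> 'i set) \<Rightarrow> (nat \<Rightarrow> 'i list \<Rightarrow> 'k) \<Rightarrow> nat set \<Rightarrow> 'i list \<Rightarrow> 'k" where
  "paste B x P = (\<lambda>l. case l of [] \<Rightarrow> 0 | i # l' \<Rightarrow> \<Sum>m\<in>{m\<in>P. i \<in> B m}. x m l)"

lemma coord_paste: "coord i (paste B x P) = (\<Sum>m\<in>{m\<in>P. i \<in> B m}. coord i (x m))"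
proof
  have *: "sum g A l = (\<Sum>m\<in>A. g m l)" for g :: "nat \<Rightarrow> 'i list \<Rightarrow> 'k" and A l
    by (induction A rule: infinite_finite_induct) (auto simp: fam_apply)
  show "coord i (paste B x P) l = (\<Sum>m\<in>{m\<in>P. i \<in> B m}. coord i (x m)) l" for l
    unfolding * by (simp add: coord_def paste_def)
qed

lemma paste_nil [simp]: "paste B x P [] = 0"
  by (simp add: paste_def)

lemma paste_in_linf:
  assumes S: "subspace S" and B: "\<And>n. B n \<subseteq> I" and x: "\<And>m. x m \<in> linf (B m) S"
    and r: "0 \<le> r" "\<And>m. m \<in> P \<Longrightarrow> supnorm (x m) \<le> r"
  shows "paste B x P \<in> linf I S" "supnorm (paste B x P) \<le> r"
proof -
  have c: "coord i (x m) \<in> S" for i m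
    using linfD(3,4)[OF x, of i m] subspaceD(2)[OF S] by (cases "i \<in> B m") auto
  have 1: "coord i (paste B x P) \<in> S" for i
    unfolding coord_paste by (rule subspace_sum[OF S c])
  have 2: "supnorm (coord i (paste B x P)) \<le> r" for i
    unfolding coord_paste
  proof (rule supnorm_sum_le[OF r(1)])
    fix m assume "m \<in> {m\<in>P. i \<in> B m}"
    then show "supnorm (coord i (x m)) \<le> r"
      using supnorm_coord_le[OF linfD(1)[OF x], of i m] r(2)[of m] by simp
  qed (rule subspaceD(1)[OF S c])
  have 3: "coord i (paste B x P) = 0" if "i \<notin> I" for i
  proof -
    have "{m\<in>P. i \<in> B m} = {}" using B that by blast
    then show ?thesis unfolding coord_paste by (simp only: sum.empty)
  qed
  have "bounded_fam (paste B x P)" "supnorm (paste B x P) \<le> r"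
    by (rule bounded_supnorm_le_coord[OF paste_nil r(1) subspaceD(1)[OF S 1] 2])+
  then show "paste B x P \<in> linf I S" "supnorm (paste B x P) \<le> r"
    unfolding linf_def using 1 3 by auto
qed

lemma paste_split:
  assumes B: "\<And>i. finite {m. i \<in> B m}" and x: "\<And>m. x m \<in> linf (B m) S"
  shows "paste B x UNIV = (\<Sum>m<n. x m) + x n + paste B x {n<..}"
proof (rule fam_eqI)
  have *: "sum g A [] = (\<Sum>m\<in>A. g m [])" for g :: "nat \<Rightarrow> 'i list \<Rightarrow> 'k" and A
    by (induction A rule: infinite_finite_induct) (auto simp: fam_apply)
  show "paste B x UNIV [] = ((\<Sum>m<n. x m) + x n + paste B x {n<..}) []"
    using linfD(2)[OF x] by (simp add: * fam_apply)
  fix i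
  have z: "coord i (x m) = 0" if "i \<notin> B m" for m
    using linfD(4)[OF x that] .
  have "(\<Sum>m\<in>{m. i \<in> B m}. coord i (x m)) =
      (\<Sum>m\<in>{m. i \<in> B m} \<inter> {..n}. coord i (x m)) + (\<Sum>m\<in>{m. i \<in> B m} - {..n}. coord i (x m))"
    by (rule sum.Int_Diff[OF B])
  also have "(\<Sum>m\<in>{m. i \<in> B m} \<inter> {..n}. coord i (x m)) = (\<Sum>m\<le>n. coord i (x m))"
    using z by (intro sum.mono_neutral_left) auto
  also have "{m. i \<in> B m} - {..n} = {m\<in>{n<..}. i \<in> B m}" by auto
  also have "(\<Sum>m\<le>n. coord i (x m)) = (\<Sum>m<n. coord i (x m)) + coord i (x n)"
    using lessThan_Suc_atMost[of n] sum.lessThan_Suc[of "\<lambda>m. coord i (x m)" n] by simp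
  finally show "coord i (paste B x UNIV) = coord i ((\<Sum>m<n. x m) + x n + paste B x {n<..})"
    by (simp add: coord_paste)
qed

text \<open>The set \<open>A\<close> is negligible for \<open>f\<close> if, on vectors supported in \<open>A\<close>, all but finitely many
  coordinates of \<open>f\<close> shrink the norm by a uniform factor.  The factor and the exceptional set are
  allowed to depend on \<open>A\<close>; this is what makes the negligible sets an ideal.\<close>
definition negligible :: "(('i list \<Rightarrow> 'k) \<Rightarrow> 'i list \<Rightarrow> 'k) \<Rightarrow> ('i list \<Rightarrow> 'k) set \<Rightarrow> 'i set \<Rightarrow> bool" where
  "negligible f S A \<longleftrightarrow> (\<exists>G q. finite G \<and> 0 \<le> q \<and> q < 1 \<and>
     (\<forall>x\<in>linf A S. \<forall>j. j \<notin> G \<longrightarrow> supnorm (coord j (f x)) \<le> q * supnorm x))"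

end

locale dense_valuation_field = complete_valuation_field +
  assumes dense: "{0..} \<subseteq> closure (range v)"
begin

lemma ex_scalar_between:
  assumes "0 \<le> a" "a < b"
  shows "\<exists>c. a < v c \<and> v c < b"
proof -
  have "(a + b) / 2 \<in> {a<..<b} \<inter> closure (range v)" using assms dense by auto
  then have "{a<..<b} \<inter> range v \<noteq> {}"
    using open_Int_closure_eq_empty[of "{a<..<b}" "range v"] open_greaterThanLessThan[of a b] by blast
  then show ?thesis by auto
qed

text \<open>If \<open>A\<close> is not negligible, some vector supported in \<open>A\<close> has a coordinate of its image that is
  almost as large as the vector itself.  Since the value group is dense, the vector can be scaled to
  have norm below \<open>r\<close> but close enough to \<open>r\<close> for this coordinate to stay above \<open>s\<close>.\<close>
lemma not_negligible_witness:
  assumes "\<not> negligible f S A" "subspace S" "A \<subseteq> I" and f: "contraction (linf I S) (c0 I W) f"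
    and "finite E" "0 < s" "s < r"
  shows "\<exists>x\<in>linf A S. \<exists>j\<in>I - E. supnorm x < r \<and> s < supnorm (coord j (f x))"
proof -
  \<comment> \<open>failure of negligibility is used with the factor \<open>s / m\<close>, so a norm above \<open>m\<close> leaves the coordinate above \<open>s\<close>\<close>
  define m where "m = (r + s) / 2"
  have m: "s < m" "m < r" "0 < m" using assms unfolding m_def by auto
  have "0 \<le> s / m" "s / m < 1" using m assms by auto
  then obtain x j where x: "x \<in> linf A S" and j: "j \<notin> E" and gt: "s / m * supnorm x < supnorm (coord j (f x))"
    using assms(1) \<open>finite E\<close> unfolding negligible_def by (meson not_le)
  have xI: "x \<in> linf I S" using x linf_mono_index[OF assms(2,3)] by blast
  have fx: "f x \<in> linf I W" using contractionD(1)[OF f xI] by (simp add: c0_def)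
  have "0 \<le> s / m * supnorm x" using m assms supnorm_nonneg[OF linfD(1)[OF x]] by simp
  then have pos: "0 < supnorm (coord j (f x))" using gt by linarith
  also have "\<dots> \<le> supnorm x"
    using supnorm_coord_le[OF linfD(1)[OF fx], of j] contractionD(2)[OF f xI] by linarith
  finally have Nx: "0 < supnorm x" .
  have "j \<in> I" using pos linfD(4)[OF fx] by fastforce
  obtain c where c: "m / supnorm x < v c" "v c < r / supnorm x"
    using ex_scalar_between[of "m / supnorm x" "r / supnorm x"] m Nx by (auto simp: divide_strict_right_mono)
  have "s = s / m * supnorm x * (m / supnorm x)" using m Nx by simp
  also have "\<dots> \<le> s / m * supnorm x * v c"
    using c(1) \<open>0 \<le> s / m * supnorm x\<close> by (intro mult_left_mono) auto
  also have "\<dots> < supnorm (coord j (f x)) * v c"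
    using gt c(1) m Nx by (intro mult_strict_right_mono) (auto intro: order.strict_trans[rotated])
  also have "\<dots> = supnorm (coord j (f (smult c x)))"
    using contractionD(4)[OF f xI] supnorm_smult[OF bounded_coord[OF linfD(1)[OF fx]]] by (simp add: mult.commute)
  finally have "s < supnorm (coord j (f (smult c x)))" .
  moreover have "supnorm (smult c x) < r"
    using c(2) Nx supnorm_smult[OF linfD(1)[OF x]] by (simp add: field_simps)
  moreover have "smult c x \<in> linf A S" using subspaceD(4)[OF subspace_linf[OF assms(2)] x] .
  ultimately show ?thesis using j \<open>j \<in> I\<close> by blast
qed

text \<open>If no \<open>B n\<close> is negligible, choose inductively humps \<open>x n\<close> supported in \<open>B n\<close> and indices \<open>j n\<close>
  such that \<open>x n\<close> has norm below \<open>r n\<close>, the coordinate \<open>j n\<close> of \<open>f (x n)\<close> has norm above \<open>r (n + 1)\<close>,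
  and at \<open>j n\<close> the images of the earlier humps have norm at most \<open>1\<close>, which excludes finitely many
  indices.  Here \<open>r n\<close> decreases strictly to \<open>1\<close>.  Let \<open>y\<close> be the sum of all humps.  The sum of the
  humps after \<open>x n\<close> has norm at most \<open>r (n + 1)\<close>, and so has its image.  Thus at \<open>j n\<close> the image of \<open>x n\<close>
  dominates all other contributions to \<open>f y\<close>.  Then \<open>f y\<close> has infinitely many coordinates of norm
  at least \<open>1\<close>, so it is not a null family.\<close>
lemma some_tail_negligible:
  fixes I :: "'i set"
  assumes S: "subspace S" and W: "subspace W" and f: "contraction (linf I S) (c0 I W) f"
    and B: "\<And>n. B n \<subseteq> I" "\<And>n. B (Suc n) \<subseteq> B n" "(\<Inter>n. B n) = {}"
  shows "\<exists>n. negligible f S (B n)"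
proof (rule ccontr)
  assume "\<not> ?thesis"
  then have nn: "\<not> negligible f S (B n)" for n by blast
  define r where "r n = 1 + 1 / (real n + 1)" for n
  have r: "1 < r n" "r (Suc n) < r n" for n unfolding r_def by (auto simp: field_simps)
  have r_anti: "r n \<le> r m" if "m \<le> n" for m n
    using that unfolding r_def by (auto simp: field_simps)
  have "\<forall>E n. \<exists>x j. finite E \<longrightarrow> x \<in> linf (B n) S \<and> j \<in> I - E \<and> supnorm x < r n \<and> r (Suc n) < supnorm (coord j (f x))"
  proof (intro allI)
    fix E :: "'i set" and n
    show "\<exists>x j. finite E \<longrightarrow> x \<in> linf (B n) S \<and> j \<in> I - E \<and> supnorm x < r n \<and> r (Suc n) < supnorm (coord j (f x))"
      using not_negligible_witness[OF nn S B(1) f, of E "r (Suc n)" "r n" n] r[of n] r(1)[of "Suc n"]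
      by (cases "finite E") auto
  qed
  then obtain X where "\<forall>E n. \<exists>j. finite E \<longrightarrow> X E n \<in> linf (B n) S \<and> j \<in> I - E \<and>
      supnorm (X E n) < r n \<and> r (Suc n) < supnorm (coord j (f (X E n)))"
    unfolding choice_iff by blast
  then obtain J where XJ: "\<And>E n. finite E \<Longrightarrow> X E n \<in> linf (B n) S \<and> J E n \<in> I - E \<and>
      supnorm (X E n) < r n \<and> r (Suc n) < supnorm (coord (J E n) (f (X E n)))"
    unfolding choice_iff by blast
  have fc0: "f x \<in> c0 I W" if "x \<in> linf I S" for x using contractionD(1)[OF f that] .
  have sub: "linf (B n) S \<subseteq> linf I S" for n by (rule linf_mono_index[OF S B(1)])
  \<comment> \<open>the indices at which the image of an earlier hump is not small\<close>
  define E where "E = rec_nat {} (\<lambda>n E. E \<union> {j\<in>I. 1 \<le> supnorm (coord j (f (X E n)))})"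
  have E_Suc: "E (Suc n) = E n \<union> {j\<in>I. 1 \<le> supnorm (coord j (f (X (E n) n)))}" for n
    unfolding E_def by simp
  have finE: "finite (E n)" for n
  proof (induction n)
    case 0 then show ?case by (simp add: E_def)
  next
    case (Suc n)
    have "f (X (E n) n) \<in> c0 I W" using XJ[OF Suc] sub fc0 by blast
    then show ?case unfolding E_Suc using Suc by (simp add: c0_def)
  qed
  define x where "x n = X (E n) n" for n
  define j where "j n = J (E n) n" for n
  have x: "x n \<in> linf (B n) S" "supnorm (x n) < r n" and j: "j n \<in> I" "j n \<notin> E n"
    and big: "r (Suc n) < supnorm (coord (j n) (f (x n)))" for n
    using XJ[OF finE, of n n] by (auto simp: x_def j_def)
  have E_later: "i \<in> E n" if "i \<in> I" "1 \<le> supnorm (coord i (f (x m)))" "m < n" for i m n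
  proof -
    have "E (Suc m) \<subseteq> E n"
      by (rule lift_Suc_mono_le) (use \<open>m < n\<close> in \<open>auto simp: E_Suc\<close>)
    then show ?thesis using that by (auto simp: E_Suc x_def)
  qed
  have finB: "finite {m. i \<in> B m}" for i
  proof -
    obtain n where n: "i \<notin> B n" using B(3) by blast
    have "{m. i \<in> B m} \<subseteq> {..<n}"
    proof
      fix m assume "m \<in> {m. i \<in> B m}"
      moreover have "B m \<subseteq> B n" if "n \<le> m" using lift_Suc_antimono_le[of B n m] B(2) that by blast
      ultimately have "\<not> n \<le> m" using n by blast
      then show "m \<in> {..<n}" by simp
    qed
    then show ?thesis by (rule finite_subset) simp
  qed
  define y where "y = paste B x UNIV"
  have y: "y \<in> linf I S"
  proof -
    have "supnorm (x m) \<le> r 0" for m using x(2)[of m] r_anti[of 0 m] by simp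
    then show ?thesis unfolding y_def using paste_in_linf(1)[OF S B(1) x(1), of "r 0" UNIV] r(1)[of 0] by simp
  qed
  have yj: "1 \<le> supnorm (coord (j n) (f y))" for n
  proof -
    define t where "t = paste B x {n<..}"
    have "supnorm (x m) \<le> r (Suc n)" if "m \<in> {n<..}" for m
      using x(2)[of m] r_anti[of "Suc n" m] that by simp
    then have t: "t \<in> linf I S" "supnorm t \<le> r (Suc n)"
      unfolding t_def using paste_in_linf[OF S B(1) x(1), of "r (Suc n)" "{n<..}"] r(1)[of "Suc n"] by simp_all
    have xI: "x m \<in> linf I S" for m using x(1) sub by blast
    have s: "(\<Sum>m<n. x m) \<in> linf I S" using subspace_sum[OF subspace_linf[OF S] xI] .
    have "f y = f (\<Sum>m<n. x m) + f (x n) + f t"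
      unfolding y_def paste_split[OF finB x(1), of n] t_def[symmetric]
      using contractionD(3)[OF f] s xI t(1) subspaceD(3)[OF subspace_linf[OF S]] by metis
    then have eq: "coord (j n) (f (x n)) =
        coord (j n) (f y) - (coord (j n) (f (\<Sum>m<n. x m)) + coord (j n) (f t))"
      by simp
    have bf: "bounded_fam (coord i (f z))" if "z \<in> linf I S" for z i
      using fc0[OF that] by (auto simp: c0_def linf_def bounded_coord)
    have "supnorm (coord (j n) (f (\<Sum>m<n. x m))) \<le> r (Suc n)"
      unfolding contraction_sum[OF f subspace_linf[OF S] xI] coord_sum
    proof (rule supnorm_sum_le)
      fix m assume "m \<in> {..<n}"
      then show "supnorm (coord (j n) (f (x m))) \<le> r (Suc n)"
        using E_later[of "j n" m n] j[of n] r(1)[of "Suc n"] by force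
    qed (use bf xI r(1)[of "Suc n"] in auto)
    moreover have "supnorm (coord (j n) (f t)) \<le> r (Suc n)"
      using supnorm_coord_le[of "f t" "j n"] contractionD(2)[OF f t(1)] t(2) fc0[OF t(1)]
      by (auto simp: c0_def linf_def)
    ultimately have "supnorm (coord (j n) (f (\<Sum>m<n. x m)) + coord (j n) (f t)) \<le> r (Suc n)"
      using supnorm_add_le[OF bf[OF s] bf[OF t(1)], of "j n" "j n"] by simp
    then show ?thesis
      using supnorm_diff_le[OF bf[OF y] bounded_add[OF bf[OF s] bf[OF t(1)]], of "j n" "j n" "j n", folded eq]
        big[of n] r(1)[of "Suc n"] by (simp add: max_def split: if_splits)
  qed
  have "j m \<noteq> j n" if "m < n" for m n
    using E_later[of "j m" m n] j[of n] j[of m] big[of m] r(1)[of "Suc m"] that by fastforce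
  then have "inj j" by (metis injI linorder_neqE_nat)
  then have "infinite (range j)" by (rule range_inj_infinite)
  moreover have "range j \<subseteq> {i\<in>I. 1 \<le> supnorm (coord i (f y))}" using yj j(1) by auto
  moreover have "finite {i\<in>I. 1 \<le> supnorm (coord i (f y))}"
    using fc0[OF y] unfolding c0_def by simp
  ultimately show False using finite_subset by blast
qed

end

section \<open>Ideals on a non-measurable set\<close>

text \<open>The hypothesis on decreasing sequences implies that an infinite sequence of disjoint sets
  outside the ideal cannot exist.  Hence, if \<open>I\<close> were outside the ideal, repeated splitting would
  reach a set \<open>A\<close> outside it that is not the disjoint union of two sets outside it.  The sets that
  contain \<open>A\<close> up to a member of the ideal then form an ultrafilter.  It is countably complete,
  because the hypothesis on decreasing sequences makes the ideal closed under countable unions.  It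
  is not principal, because finite sets lie in the ideal.  The same closure property shows that \<open>I\<close>
  is uncountable.\<close>

lemma ideal_improper:
  fixes I :: "'i set" and \<N> :: "'i set set"
  assumes nm: "\<not> omega1_measurable I"
    and down: "\<And>A B. A \<in> \<N> \<Longrightarrow> B \<subseteq> A \<Longrightarrow> B \<in> \<N>"
    and un: "\<And>A B. A \<in> \<N> \<Longrightarrow> B \<in> \<N> \<Longrightarrow> A \<union> B \<in> \<N>"
    and fin: "\<And>A. finite A \<Longrightarrow> A \<in> \<N>"
    and tail: "\<And>B :: nat \<Rightarrow> 'i set. (\<And>n. B n \<subseteq> I) \<Longrightarrow> (\<And>n. B (Suc n) \<subseteq> B n) \<Longrightarrow> (\<Inter>n. B n) = {} \<Longrightarrow>
      \<exists>n. B n \<in> \<N>"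
  shows "I \<in> \<N>"
proof (rule ccontr)
  assume I: "I \<notin> \<N>"
  have "\<exists>A. A \<subseteq> I \<and> A \<notin> \<N> \<and> (\<forall>C\<subseteq>A. C \<in> \<N> \<or> A - C \<in> \<N>)"
  proof (rule ccontr)
    assume "\<not> ?thesis"
    then have "\<forall>A. \<exists>C. A \<subseteq> I \<and> A \<notin> \<N> \<longrightarrow> C \<subseteq> A \<and> C \<notin> \<N> \<and> A - C \<notin> \<N>" by blast
    then obtain s where s: "\<And>A. A \<subseteq> I \<Longrightarrow> A \<notin> \<N> \<Longrightarrow> s A \<subseteq> A \<and> s A \<notin> \<N> \<and> A - s A \<notin> \<N>"
      unfolding choice_iff by blast
    define C where "C n = (s ^^ n) I" for n
    have C: "C n \<subseteq> I \<and> C n \<notin> \<N>" for n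
    proof (induction n)
      case (Suc n)
      then show ?case using s[of "C n"] by (auto simp: C_def)
    qed (simp add: C_def I)
    have step: "C (Suc n) \<subseteq> C n" "C n - C (Suc n) \<notin> \<N>" for n
      using s[of "C n"] C[of n] by (auto simp: C_def)
    \<comment> \<open>each tail contains the difference of two consecutive terms, which is not in the ideal\<close>
    define B where "B n = C n - (\<Inter>m. C m)" for n
    have "\<exists>n. B n \<in> \<N>"
      by (rule tail) (use C step in \<open>auto simp: B_def\<close>)
    then obtain n where "B n \<in> \<N>" ..
    then have "C n - C (Suc n) \<in> \<N>" by (rule down) (auto simp: B_def)
    then show False using step by blast
  qed
  then obtain A where A: "A \<subseteq> I" "A \<notin> \<N>" and split: "\<And>C. C \<subseteq> A \<Longrightarrow> C \<in> \<N> \<or> A - C \<in> \<N>"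
    by blast
  have union: "(\<Union>n. P n) \<in> \<N>" if P: "\<And>n. P n \<subseteq> I" "\<And>n. P n \<in> \<N>" for P :: "nat \<Rightarrow> 'i set"
  proof -
    have le: "(\<Union>m\<le>n. P m) \<in> \<N>" for n
    proof (induction n)
      case (Suc n)
      then show ?case using un[OF P(2)[of "Suc n"]] by (simp add: atMost_Suc)
    qed (simp add: P)
    have "\<exists>n. (\<Union>m. P m) - (\<Union>m\<le>n. P m) \<in> \<N>"
      by (rule tail) (use P in \<open>auto simp: atMost_Suc\<close>)
    then obtain n where "(\<Union>m. P m) - (\<Union>m\<le>n. P m) \<in> \<N>" ..
    from un[OF this le[of n]] show ?thesis by (rule down) auto
  qed
  define U where "U = {B. B \<subseteq> I \<and> A - B \<in> \<N>}"
  have "ultrafilter_on I U"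
    unfolding ultrafilter_on_def
  proof (intro conjI)
    show "U \<subseteq> Pow I" "I \<in> U" "{} \<notin> U" using A fin[of "{}"] by (auto simp: U_def Diff_eq_empty_iff[THEN iffD2])
    show "\<forall>B\<in>U. \<forall>C. B \<subseteq> C \<and> C \<subseteq> I \<longrightarrow> C \<in> U"
    proof (intro ballI allI impI)
      fix B C assume "B \<in> U" "B \<subseteq> C \<and> C \<subseteq> I"
      then show "C \<in> U" using down[of "A - B" "A - C"] by (auto simp: U_def)
    qed
    show "\<forall>B\<in>U. \<forall>C\<in>U. B \<inter> C \<in> U"
    proof (intro ballI)
      fix B C assume "B \<in> U" "C \<in> U"
      then show "B \<inter> C \<in> U" using un[of "A - B" "A - C"] by (auto simp: U_def Diff_Int)
    qed
    show "\<forall>B. B \<subseteq> I \<longrightarrow> B \<in> U \<or> I - B \<in> U"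
    proof (intro allI impI)
      fix B assume "B \<subseteq> I"
      have "A - (I - B) = A \<inter> B" "A - A \<inter> B = A - B" using A by auto
      then show "B \<in> U \<or> I - B \<in> U" using split[of "A \<inter> B"] \<open>B \<subseteq> I\<close> by (auto simp: U_def)
    qed
  qed
  moreover have "\<Inter>\<A> \<in> U" if "\<A> \<subseteq> U" "\<A> \<noteq> {}" "countable \<A>" for \<A>
  proof -
    have B: "range (from_nat_into \<A>) = \<A>" using that by (simp add: range_from_nat_into)
    have "(\<Union>n. A - from_nat_into \<A> n) \<in> \<N>"
    proof (rule union)
      show "A - from_nat_into \<A> n \<subseteq> I" "A - from_nat_into \<A> n \<in> \<N>" for n
        using A from_nat_into[OF that(2), of n] that(1) by (auto simp: U_def)
    qed
    also have "(\<Union>n. A - from_nat_into \<A> n) = A - \<Inter>(range (from_nat_into \<A>))" by auto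
    finally show ?thesis unfolding B using that(1,2) by (auto simp: U_def)
  qed
  moreover have "\<not> principal_on I U"
  proof
    assume "principal_on I U"
    then obtain x where "x \<in> I" "U = {B. B \<subseteq> I \<and> x \<in> B}" by (auto simp: principal_on_def)
    then have "{x} \<in> U" by auto
    then have "A - {x} \<in> \<N>" by (simp add: U_def)
    from un[OF this fin[of "{x}"]] have "A \<in> \<N>" by (rule down) auto
    then show False using A by blast
  qed
  moreover have "uncountable I"
  proof
    assume "countable I"
    have "I \<noteq> {}" using I fin by blast
    then have "(\<Union>n. {from_nat_into I n}) \<in> \<N>"
      by (intro union) (auto simp: fin from_nat_into)
    also have "(\<Union>n. {from_nat_into I n}) = I"
      using range_from_nat_into[OF \<open>I \<noteq> {}\<close> \<open>countable I\<close>] by auto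
    finally show False using I by blast
  qed
  ultimately show False using nm unfolding omega1_measurable_def by blast
qed

section \<open>Contractions from bounded families to null families\<close>

context dense_valuation_field
begin

lemma negligible_mono:
  assumes "negligible f S A" "subspace S" "B \<subseteq> A"
  shows "negligible f S B"
  using assms(1) linf_mono_index[OF assms(2,3)] unfolding negligible_def by blast

lemma negligible_union:
  assumes S: "subspace S" and W: "subspace W" and f: "contraction (linf I S) (c0 I W) f"
    and A: "negligible f S A" "A \<subseteq> I" and B: "negligible f S B" "B \<subseteq> I"
  shows "negligible f S (A \<union> B)"
proof -
  obtain G q where G: "finite G" "0 \<le> q" "q < 1"
    "\<And>x j. x \<in> linf A S \<Longrightarrow> j \<notin> G \<Longrightarrow> supnorm (coord j (f x)) \<le> q * supnorm x"
    using A unfolding negligible_def by blast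
  obtain H p where H: "finite H" "0 \<le> p" "p < 1"
    "\<And>x j. x \<in> linf B S \<Longrightarrow> j \<notin> H \<Longrightarrow> supnorm (coord j (f x)) \<le> p * supnorm x"
    using B unfolding negligible_def by blast
  have "supnorm (coord j (f x)) \<le> max p q * supnorm x" if x: "x \<in> linf (A \<union> B) S" and j: "j \<notin> G \<union> H" for x j
  proof -
    define y z where "y = cut A x" and "z = cut (B - A) x"
    have "A \<inter> (A \<union> B) = A" "(B - A) \<inter> (A \<union> B) = B - A" by auto
    then have y: "y \<in> linf A S" and z: "z \<in> linf B S"
      using cut_in_linf[OF S x, of A] cut_in_linf[OF S x, of "B - A"] linf_mono_index[OF S, of "B - A" B]
      by (auto simp: y_def z_def)
    have yz: "y \<in> linf I S" "z \<in> linf I S" using y z linf_mono_index[OF S] A B by blast+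
    have "x = y + z"
    proof (rule fam_eqI)
      show "x [] = (y + z) []" using linfD(2)[OF x] by (simp add: y_def z_def fam_apply)
      show "coord i x = coord i (y + z)" for i
        using linfD(4)[OF x, of i] by (auto simp: y_def z_def)
    qed
    then have fx: "f x = f y + f z" using contractionD(3)[OF f yz] by simp
    have b: "bounded_fam (coord i (f w))" if "w \<in> linf I S" for w i
      using contractionD(1)[OF f that] by (auto simp: c0_def linf_def bounded_coord)
    have bx: "bounded_fam x" by (rule linfD(1)[OF x])
    have "supnorm (coord j (f y)) \<le> q * supnorm y" using G(4)[OF y] j by simp
    also have "\<dots> \<le> max p q * supnorm x"
      using G(2) bounded_cut(2)[OF bx] supnorm_nonneg[OF bounded_cut(1)[OF bx]] unfolding y_def by (intro mult_mono) auto
    finally have 1: "supnorm (coord j (f y)) \<le> max p q * supnorm x" .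
    have "supnorm (coord j (f z)) \<le> p * supnorm z" using H(4)[OF z] j by simp
    also have "\<dots> \<le> max p q * supnorm x"
      using H(2) bounded_cut(2)[OF bx] supnorm_nonneg[OF bounded_cut(1)[OF bx]] unfolding z_def by (intro mult_mono) auto
    finally have 2: "supnorm (coord j (f z)) \<le> max p q * supnorm x" .
    show ?thesis unfolding fx using supnorm_add_le[OF b[OF yz(1)] b[OF yz(2)], of j j] 1 2 by simp
  qed
  then show ?thesis
    using G(1-3) H(1-3) unfolding negligible_def by (intro exI[of _ "G \<union> H"] exI[of _ "max p q"]) auto
qed

text \<open>The sets that are negligible up to finitely many indices form an ideal to which
  \<open>ideal_improper\<close> applies.\<close>
lemma ex_finite_negligible_complement:
  assumes S: "subspace S" and W: "subspace W" and f: "contraction (linf I S) (c0 I W) f"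
    and nm: "\<not> omega1_measurable I"
  shows "\<exists>F. finite F \<and> negligible f S (I - F)"
proof -
  define \<N> where "\<N> = {A. \<exists>F. finite F \<and> negligible f S (A \<inter> I - F)}"
  have neg_in: "A \<in> \<N>" if "negligible f S (A \<inter> I)" for A
    using that unfolding \<N>_def by (intro CollectI exI[of _ "{}"]) simp
  have "\<exists>n. negligible f S (B n)" if "\<And>n. B n \<subseteq> I" "\<And>n. B (Suc n) \<subseteq> B n" "(\<Inter>n. B n) = {}" for B
    by (rule some_tail_negligible[OF S W f that])
  from this[of "\<lambda>_. {}"] have empty: "negligible f S {}" by simp
  have "I \<in> \<N>"
  proof (rule ideal_improper[OF nm])
    fix A B assume "A \<in> \<N>" "B \<subseteq> A"
    then obtain F where "finite F" "negligible f S (A \<inter> I - F)" by (auto simp: \<N>_def)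
    moreover have "B \<inter> I - F \<subseteq> A \<inter> I - F" using \<open>B \<subseteq> A\<close> by auto
    ultimately show "B \<in> \<N>" using negligible_mono[OF _ S] by (auto simp: \<N>_def)
  next
    fix A B assume "A \<in> \<N>" "B \<in> \<N>"
    then obtain F G where FG: "finite F" "negligible f S (A \<inter> I - F)" "finite G" "negligible f S (B \<inter> I - G)"
      by (auto simp: \<N>_def)
    have "negligible f S ((A \<inter> I - F) \<union> (B \<inter> I - G))"
      by (rule negligible_union[OF S W f FG(2) _ FG(4)]) auto
    then have "negligible f S ((A \<union> B) \<inter> I - (F \<union> G))" by (rule negligible_mono[OF _ S]) auto
    then show "A \<union> B \<in> \<N>" using FG by (auto simp: \<N>_def)
  next
    fix A :: "'b set" assume "finite A"
    then show "A \<in> \<N>" using empty by (auto simp: \<N>_def intro!: exI[of _ A] negligible_mono[OF empty S])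
  next
    fix B :: "nat \<Rightarrow> 'b set"
    assume B: "\<And>n. B n \<subseteq> I" "\<And>n. B (Suc n) \<subseteq> B n" "(\<Inter>n. B n) = {}"
    then obtain n where "negligible f S (B n)" using some_tail_negligible[OF S W f B] by blast
    then show "\<exists>n. B n \<in> \<N>" using B(1)[of n] by (auto intro!: exI[of _ n] neg_in simp: Int_absorb2)
  qed
  then show ?thesis by (auto simp: \<N>_def)
qed

end

section \<open>Spaces that nearly factor through another space\<close>

context complete_valuation_field
begin

definition nearly_factors :: "('i list \<Rightarrow> 'k) set \<Rightarrow> ('i list \<Rightarrow> 'k) set \<Rightarrow> bool" where
  "nearly_factors S M \<longleftrightarrow>
     (\<exists>T q. factors S M S T \<and> 0 \<le> q \<and> q < 1 \<and> (\<forall>x\<in>S. supnorm (T x - x) \<le> q * supnorm x))"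

lemma nearly_factors_of_retract:
  assumes a: "contraction R M a" and b: "contraction M R b" and ba: "\<And>x. x \<in> R \<Longrightarrow> b (a x) = x"
  shows "nearly_factors R M"
  unfolding nearly_factors_def
  using ba by (intro exI[of _ "\<lambda>x. b (a x)"] exI[of _ 0]) (auto intro: factors_single[OF a b])

text \<open>A map that only uses finitely many coordinates of a space \<open>Y\<close> of families in \<open>W\<close> factors through
  a finite power of \<open>W\<close>.\<close>
lemma factors_cut:
  assumes i: "contraction X Y i" and p: "contraction Y X' p"
    and W: "subspace W" and Y: "subspace Y" "c0 I W \<subseteq> Y" "Y \<subseteq> linf I W"
  shows "finite F \<Longrightarrow> F \<subseteq> I \<Longrightarrow> factors X W X' (\<lambda>x. p (cut F (i x)))"
proof (induction F rule: finite_induct)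
  case empty
  then show ?case using contraction_zero[OF p Y(1)] by (intro factors.zero) simp
next
  case (insert j F)
  then have j: "{j} \<subseteq> I" "finite {j}" and F: "F \<subseteq> I" by auto
  have c: "contraction X W (\<lambda>x. coord j (i x))"
    using contraction_comp[OF i contraction_mono[OF contraction_coord[OF W, of j I] Y(3) subset_refl]] j by simp
  have s: "contraction W Y (single j)"
    using contraction_mono[OF contraction_single[OF W] subset_refl]
      linf_finite_subset_c0[OF W j] Y(2) by blast
  show ?case
  proof (rule factors.step[OF c contraction_comp[OF s p] insert.IH[OF F]])
    fix x assume "x \<in> X"
    then have y: "i x \<in> Y" by (rule contractionD(1)[OF i])
    have "cut (insert j F) (i x) = single j (coord j (i x)) + cut F (i x)"
      by (rule fam_eqI) (use insert.hyps in \<open>auto simp: fam_apply\<close>)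
    moreover have "single j (coord j (i x)) \<in> Y"
      using contractionD(1)[OF s contractionD(1)[OF c \<open>x \<in> X\<close>]] .
    moreover have "cut F (i x) \<in> Y"
    proof -
      have "cut F (i x) \<in> linf F W"
        using cut_in_linf[OF W, of "i x" I F] y Y(3) F by (auto simp: Int_absorb2)
      then show ?thesis using linf_finite_subset_c0[OF W F insert.hyps(1)] Y(2) by blast
    qed
    ultimately show "p (cut (insert j F) (i x)) = p (single j (coord j (i x))) + p (cut F (i x))"
      using contractionD(3)[OF p] by simp
  qed
qed

text \<open>Applied with \<open>linf I S\<close> or \<open>c0 I S\<close> as \<open>X\<close>.  The map \<open>T\<close> is close to the identity off a
  finite set of indices in the source and in the target; compressing \<open>T\<close> to one coordinate off this
  set gives the first claim.  For the second claim, the compression to a single coordinate would lose the infinite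
  dimension.  Instead, \<open>T\<close> is applied to a vector in its kernel that is supported off the finite
  set.\<close>
lemma nearly_factors_descend:
  assumes S: "subspace S" and X: "subspace X" "c0 I S \<subseteq> X" "X \<subseteq> linf I S" and I: "infinite I"
    and F: "finite F" and T: "factors X M X T" and q: "0 \<le> q" "q < 1"
    and near: "\<And>x j. x \<in> X \<Longrightarrow> x \<in> linf (I - F) S \<Longrightarrow> j \<in> I - F \<Longrightarrow> supnorm (coord j (T x - x)) \<le> q * supnorm x"
  shows "nearly_factors S M" "M = scalars \<Longrightarrow> S = {0}"
proof -
  have inf: "infinite (I - F)" using I F by simp
  then obtain j where j: "j \<in> I - F" using infinite_imp_nonempty by blast
  then have jI: "{j} \<subseteq> I" "finite {j}" "j \<in> I" by auto
  have jX: "linf {j} S \<subseteq> X" using linf_finite_subset_c0[OF S jI(1,2)] X(2) by blast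
  have s: "contraction S X (single j)"
    by (rule contraction_mono[OF contraction_single[OF S] subset_refl jX])
  have c: "contraction X S (coord j)"
    by (rule contraction_mono[OF contraction_coord[OF S jI(3)] X(3) subset_refl])
  have "supnorm (coord j (T (single j u)) - u) \<le> q * supnorm u" if u: "u \<in> S" for u
  proof -
    have 1: "single j u \<in> linf {j} S" using contractionD(1)[OF contraction_single[OF S] u] .
    then have "single j u \<in> X" "single j u \<in> linf (I - F) S"
      using jX linf_mono_index[OF S, of "{j}" "I - F"] j by auto
    from near[OF this j] have "supnorm (coord j (T (single j u)) - u) \<le> q * supnorm (single j u)" by simp
    also have "\<dots> \<le> q * supnorm u"
      using bounded_single(2)[OF subspaceD(1)[OF S u]] q by (intro mult_left_mono)
    finally show ?thesis .
  qed
  then show "nearly_factors S M"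
    using factors_comp[OF T s c X(1) X(1)] q unfolding nearly_factors_def by blast
  show "S = {0}" if M: "M = scalars"
  proof (rule ccontr)
    assume "S \<noteq> {0}"
    then obtain u where u: "u \<in> S" "u \<noteq> 0" using subspaceD(2)[OF S] by blast
    obtain K x where K: "finite K" "K \<subseteq> I - F" and x: "x \<in> linf K S" "x \<noteq> 0" "T x = 0"
      using factors_scalars_kernel[OF T[unfolded M] X(1) X(1) S X(2) u inf] by blast
    have xX: "x \<in> X" using linf_finite_subset_c0[OF S _ K(1)] K(2) x(1) X(2) by blast
    have xF: "x \<in> linf (I - F) S" using linf_mono_index[OF S K(2)] x(1) by blast
    have b: "bounded_fam x" by (rule linfD(1)[OF xF])
    have "supnorm (coord i x) \<le> q * supnorm x" for i
    proof (cases "i \<in> I - F")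
      case True
      from near[OF xX xF this] show ?thesis using x(3) by (simp add: coord_simps(2)[of i 0 x, simplified])
    next
      case False
      then show ?thesis using linfD(4)[OF xF False] q supnorm_nonneg[OF b] by simp
    qed
    then have "supnorm x \<le> q * supnorm x"
      using bounded_supnorm_le_coord(2)[of x "q * supnorm x"] linfD(2)[OF xF] q supnorm_nonneg[OF b] bounded_coord[OF b] by simp
    moreover have "q * supnorm x < 1 * supnorm x" using q supnorm_pos[OF b x(2)] by (intro mult_strict_right_mono)
    ultimately show False by simp
  qed
qed

end

context dense_valuation_field
begin

text \<open>In each summand \<open>p \<circ> i\<close> all but finitely many coordinates of \<open>i x\<close> are small for \<open>x\<close> supported off
  a finite set, and \<open>factors_cut\<close> applies to the remaining ones.\<close>
lemma factors_through_c0: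
  assumes "factors (linf I S) (c0 I W) X' T" and S: "subspace S" and W: "subspace W" and X': "subspace X'"
    and nm: "\<not> omega1_measurable I"
  shows "\<exists>F q T'. finite F \<and> 0 \<le> q \<and> q < 1 \<and> factors (linf I S) W X' T' \<and>
    (\<forall>x\<in>linf (I - F) S. supnorm (T x - T' x) \<le> q * supnorm x)"
  using assms(1)
proof induction
  case (zero T)
  have "factors (linf I S) W X' T" by (rule factors.zero[OF zero])
  then show ?case by (intro exI[of _ "{}"] exI[of _ "0 :: real"] exI[of _ T]) simp
next
  case (step i p T U)
  obtain F1 q1 T' where 1: "finite F1" "0 \<le> q1" "q1 < 1" "factors (linf I S) W X' T'"
    "\<And>x. x \<in> linf (I - F1) S \<Longrightarrow> supnorm (T x - T' x) \<le> q1 * supnorm x"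
    using step.IH by blast
  obtain F2 G q2 where 2: "finite F2" "finite G" "0 \<le> q2" "q2 < 1"
    "\<And>x j. x \<in> linf (I - F2) S \<Longrightarrow> j \<notin> G \<Longrightarrow> supnorm (coord j (i x)) \<le> q2 * supnorm x"
    using ex_finite_negligible_complement[OF S W step.hyps(1) nm] unfolding negligible_def by blast
  \<comment> \<open>only the coordinates in \<open>G\<close> of \<open>i x\<close> are kept\<close>
  define U' where "U' x = p (cut (G \<inter> I) (i x)) + T' x" for x
  have "factors (linf I S) W X' U'"
    unfolding U'_def using 2(2)
    by (intro factors_add 1(4) factors_cut[OF step.hyps(1,2) W subspace_c0[OF W] _ c0_subset_linf]) auto
  moreover have "supnorm (U x - U' x) \<le> max q1 q2 * supnorm x" if x: "x \<in> linf (I - (F1 \<union> F2)) S" for x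
  proof -
    have xI: "x \<in> linf I S" and x1: "x \<in> linf (I - F1) S" and x2: "x \<in> linf (I - F2) S"
      using x linf_mono_index[OF S, of "I - (F1 \<union> F2)" I] linf_mono_index[OF S, of "I - (F1 \<union> F2)" "I - F1"]
        linf_mono_index[OF S, of "I - (F1 \<union> F2)" "I - F2"] by auto
    have Nx: "0 \<le> supnorm x" using supnorm_nonneg[OF linfD(1)[OF x]] .
    define y where "y = i x"
    have y: "y \<in> c0 I W" unfolding y_def by (rule contractionD(1)[OF step.hyps(1) xI])
    then have yI: "y \<in> linf I W" by (simp add: c0_def)
    have cy: "cut (G \<inter> I) y \<in> c0 I W"
      using cut_in_linf[OF W yI, of "G \<inter> I"] linf_finite_subset_c0[OF W, of "G \<inter> I" I] 2(2)
      by (auto simp: Int_assoc)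
    define z where "z = y - cut (G \<inter> I) y"
    have z: "z \<in> c0 I W" unfolding z_def by (rule subspaceD(6)[OF subspace_c0[OF W] y cy])
    have bz: "bounded_fam (coord j z)" for j
      using z by (auto simp: c0_def linf_def bounded_coord)
    have "supnorm (coord j z) \<le> q2 * supnorm x" for j
      using 2(5)[OF x2, of j] linfD(4)[OF yI, of j] 2(3) Nx by (auto simp: z_def y_def)
    then have Nz: "supnorm z \<le> q2 * supnorm x"
      using bounded_supnorm_le_coord(2)[of z "q2 * supnorm x"] z bz 2(3) Nx by (auto simp: c0_def linf_def)
    have pz: "p z = p y - p (cut (G \<inter> I) y)"
      unfolding z_def by (rule contraction_diff[OF step.hyps(2) subspace_c0[OF W] y cy])
    have "U x - U' x = p z + (T x - T' x)"
      by (simp add: step.hyps(4)[OF xI] U'_def y_def[symmetric] pz)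
    moreover have "supnorm (p z) \<le> q2 * supnorm x" using contractionD(2)[OF step.hyps(2) z] Nz by simp
    moreover have "bounded_fam (p z)" using subspaceD(1)[OF X' contractionD(1)[OF step.hyps(2) z]] .
    moreover have "bounded_fam (T x - T' x)"
      using contractionD(1)[OF factors_contraction[OF step.hyps(3) subspace_linf[OF S] X'] xI]
        contractionD(1)[OF factors_contraction[OF 1(4) subspace_linf[OF S] X'] xI]
      by (intro subspaceD(1)[OF X'] subspaceD(6)[OF X'])
    ultimately have "supnorm (U x - U' x) \<le> max (q2 * supnorm x) (q1 * supnorm x)"
      using supnorm_add_le[of "p z" "T x - T' x"] 1(5)[OF x1] by simp
    then show ?thesis using Nx by (simp add: max_mult_distrib_right max.commute)
  qed
  ultimately show ?case using 1(1-3) 2(1,3,4)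
    by (intro exI[of _ "F1 \<union> F2"] exI[of _ "max q1 q2"] exI[of _ U']) auto
qed

text \<open>In contrast to \<open>factors_through_c0\<close>, the finite set of indices that has to be avoided is now in
  the target: only the coordinates of \<open>p y\<close> outside it are determined, up to the error, by finitely many
  coordinates of \<open>y\<close>.\<close>
lemma factors_through_linf:
  assumes "factors X (linf I S) (c0 I W) T" and S: "subspace S" and W: "subspace W" and X: "subspace X"
    and nm: "\<not> omega1_measurable I"
  shows "\<exists>F q T'. finite F \<and> 0 \<le> q \<and> q < 1 \<and> factors X S (c0 I W) T' \<and>
    (\<forall>x\<in>X. \<forall>j. j \<notin> F \<longrightarrow> supnorm (coord j (T x - T' x)) \<le> q * supnorm x)"
  using assms(1)
proof induction
  case (zero T)
  have "factors X S (c0 I W) T" by (rule factors.zero[OF zero])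
  then show ?case by (intro exI[of _ "{}"] exI[of _ "0 :: real"] exI[of _ T]) simp
next
  case (step i p T U)
  obtain F1 q1 T' where 1: "finite F1" "0 \<le> q1" "q1 < 1" "factors X S (c0 I W) T'"
    "\<And>x j. x \<in> X \<Longrightarrow> j \<notin> F1 \<Longrightarrow> supnorm (coord j (T x - T' x)) \<le> q1 * supnorm x"
    using step.IH by blast
  obtain F G q2 where 2: "finite F" "finite G" "0 \<le> q2" "q2 < 1"
    "\<And>x j. x \<in> linf (I - F) S \<Longrightarrow> j \<notin> G \<Longrightarrow> supnorm (coord j (p x)) \<le> q2 * supnorm x"
    using ex_finite_negligible_complement[OF S W step.hyps(2) nm] unfolding negligible_def by blast
  \<comment> \<open>only the coordinates in \<open>F\<close> of \<open>i x\<close> are kept\<close>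
  define U' where "U' x = p (cut (F \<inter> I) (i x)) + T' x" for x
  have "factors X S (c0 I W) U'"
    unfolding U'_def using 2(1)
    by (intro factors_add 1(4) factors_cut[OF step.hyps(1,2) S subspace_linf[OF S] c0_subset_linf]) auto
  moreover have "supnorm (coord j (U x - U' x)) \<le> max q1 q2 * supnorm x" if x: "x \<in> X" and j: "j \<notin> F1 \<union> G" for x j
  proof -
    have Nx: "0 \<le> supnorm x" using supnorm_nonneg[OF subspaceD(1)[OF X x]] .
    define y where "y = i x"
    have y: "y \<in> linf I S" unfolding y_def by (rule contractionD(1)[OF step.hyps(1) x])
    have cy: "cut (F \<inter> I) y \<in> linf I S" by (rule cut_in_linf'[OF S y])
    define z where "z = cut (I - F) y"
    have zeq: "z = y - cut (F \<inter> I) y"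
      by (rule fam_eqI) (use linfD(2,4)[OF y] in \<open>auto simp: z_def fam_apply\<close>)
    have z: "z \<in> linf (I - F) S" using cut_in_linf[OF S y, of "I - F"]
      by (simp add: z_def Int_absorb2)
    have zI: "z \<in> linf I S" using z linf_mono_index[OF S, of "I - F" I] by auto
    have "supnorm z \<le> supnorm x"
      using bounded_cut(2)[OF linfD(1)[OF y], of "I - F"] contractionD(2)[OF step.hyps(1) x]
      by (simp add: z_def y_def)
    then have "q2 * supnorm z \<le> q2 * supnorm x" using 2(3) by (intro mult_left_mono)
    then have Np: "supnorm (coord j (p z)) \<le> q2 * supnorm x" using 2(5)[OF z, of j] j by simp
    have pz: "p z = p y - p (cut (F \<inter> I) y)"
      unfolding zeq by (rule contraction_diff[OF step.hyps(2) subspace_linf[OF S] y cy])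
    have "coord j (U x - U' x) = coord j (p z) + coord j (T x - T' x)"
      by (simp add: step.hyps(4)[OF x] U'_def y_def[symmetric] pz)
    moreover have "bounded_fam (coord j (p z))"
      using subspaceD(1)[OF subspace_c0[OF W] contractionD(1)[OF step.hyps(2) zI]] by (rule bounded_coord)
    moreover have "bounded_fam (coord j (T x - T' x))"
      using contractionD(1)[OF factors_contraction[OF step.hyps(3) X subspace_c0[OF W]] x]
        contractionD(1)[OF factors_contraction[OF 1(4) X subspace_c0[OF W]] x]
      by (intro bounded_coord subspaceD(1)[OF subspace_c0[OF W]] subspaceD(6)[OF subspace_c0[OF W]])
    ultimately have "supnorm (coord j (U x - U' x)) \<le> max (q2 * supnorm x) (q1 * supnorm x)"
      using supnorm_add_le[of "coord j (p z)" "coord j (T x - T' x)"] 1(5)[OF x, of j] Np j by simp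
    then show ?thesis using Nx by (simp add: max_mult_distrib_right max.commute)
  qed
  ultimately show ?case using 1(1-3) 2(2-4)
    by (intro exI[of _ "F1 \<union> G"] exI[of _ "max q1 q2"] exI[of _ U']) auto
qed

lemma nearly_factors_linf_c0:
  assumes S: "subspace S" and W: "subspace W" and I: "infinite I" "\<not> omega1_measurable I"
    and "nearly_factors (linf I S) (c0 I W)"
  shows "nearly_factors S W" "W = scalars \<Longrightarrow> S = {0}"
proof -
  note E = subspace_linf[OF S, of I]
  obtain T q where T: "factors (linf I S) (c0 I W) (linf I S) T" "0 \<le> q" "q < 1"
    "\<And>x. x \<in> linf I S \<Longrightarrow> supnorm (T x - x) \<le> q * supnorm x"
    using assms(5) unfolding nearly_factors_def by blast
  obtain F p T' where F: "finite F" "0 \<le> p" "p < 1" "factors (linf I S) W (linf I S) T'"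
    "\<And>x. x \<in> linf (I - F) S \<Longrightarrow> supnorm (T x - T' x) \<le> p * supnorm x"
    using factors_through_c0[OF T(1) S W E I(2)] by blast
  have near: "supnorm (coord j (T' x - x)) \<le> max q p * supnorm x" if x: "x \<in> linf I S" "x \<in> linf (I - F) S" for x j
  proof -
    have Tx: "T x \<in> linf I S" "T' x \<in> linf I S"
      using contractionD(1)[OF factors_contraction[OF T(1) E E] x(1)]
        contractionD(1)[OF factors_contraction[OF F(4) E E] x(1)] .
    note b = subspaceD(1)[OF E subspaceD(6)[OF E]]
    have eq: "T' x - x = (T x - x) - (T x - T' x)" by simp
    have "supnorm (coord j (T' x - x)) \<le> supnorm (T' x - x)" by (rule supnorm_coord_le[OF b[OF Tx(2) x(1)]])
    also have "\<dots> \<le> max (supnorm (T x - x)) (supnorm (T x - T' x))"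
      unfolding eq by (rule supnorm_diff_le[OF b[OF Tx(1) x(1)] b[OF Tx]])
    also have "\<dots> \<le> max (q * supnorm x) (p * supnorm x)" using T(4)[OF x(1)] F(5)[OF x(2)] by (intro max.mono)
    also have "\<dots> = max q p * supnorm x" using supnorm_nonneg[OF linfD(1)[OF x(1)]] by (simp add: max_mult_distrib_right)
    finally show ?thesis .
  qed
  note D = nearly_factors_descend[OF S E c0_subset_linf subset_refl I(1) F(1) F(4) _ _ near]
  show "nearly_factors S W" "W = scalars \<Longrightarrow> S = {0}" using D T(2,3) F(2,3) by simp_all
qed

lemma nearly_factors_c0_linf:
  assumes S: "subspace S" and W: "subspace W" and I: "infinite I" "\<not> omega1_measurable I"
    and "nearly_factors (c0 I S) (linf I W)"
  shows "nearly_factors S W" "W = scalars \<Longrightarrow> S = {0}"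
proof -
  note E = subspace_c0[OF S, of I]
  obtain T q where T: "factors (c0 I S) (linf I W) (c0 I S) T" "0 \<le> q" "q < 1"
    "\<And>x. x \<in> c0 I S \<Longrightarrow> supnorm (T x - x) \<le> q * supnorm x"
    using assms(5) unfolding nearly_factors_def by blast
  obtain F p T' where F: "finite F" "0 \<le> p" "p < 1" "factors (c0 I S) W (c0 I S) T'"
    "\<And>x j. x \<in> c0 I S \<Longrightarrow> j \<notin> F \<Longrightarrow> supnorm (coord j (T x - T' x)) \<le> p * supnorm x"
    using factors_through_linf[OF T(1) W S E I(2)] by blast
  have near: "supnorm (coord j (T' x - x)) \<le> max q p * supnorm x" if x: "x \<in> c0 I S" and j: "j \<in> I - F" for x j
  proof -
    have Tx: "T x \<in> c0 I S" "T' x \<in> c0 I S"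
      using contractionD(1)[OF factors_contraction[OF T(1) E E] x]
        contractionD(1)[OF factors_contraction[OF F(4) E E] x] .
    note b = subspaceD(1)[OF E subspaceD(6)[OF E]]
    have eq: "coord j (T' x - x) = coord j (T x - x) - coord j (T x - T' x)" by simp
    have "supnorm (coord j (T' x - x)) \<le> max (supnorm (coord j (T x - x))) (supnorm (coord j (T x - T' x)))"
      unfolding eq by (rule supnorm_diff_le[OF bounded_coord[OF b[OF Tx(1) x]] bounded_coord[OF b[OF Tx]]])
    also have "\<dots> \<le> max (q * supnorm x) (p * supnorm x)"
      using order_trans[OF supnorm_coord_le[OF b[OF Tx(1) x]] T(4)[OF x]] F(5)[OF x] j by (intro max.mono) auto
    also have "\<dots> = max q p * supnorm x"
      using supnorm_nonneg[OF subspaceD(1)[OF E x]] by (simp add: max_mult_distrib_right)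
    finally show ?thesis .
  qed
  note D = nearly_factors_descend[OF S E subset_refl c0_subset_linf I(1) F(1) F(4) _ _ near]
  show "nearly_factors S W" "W = scalars \<Longrightarrow> S = {0}" using D T(2,3) F(2,3) by simp_all
qed

end

section \<open>The iterated spaces as spaces of functions on sequences\<close>

context complete_valuation_field
begin

primrec V_fam :: "'i set \<Rightarrow> nat \<Rightarrow> nat \<Rightarrow> ('i list \<Rightarrow> 'k) set" where
  "V_fam I t 0 = scalars"
| "V_fam I t (Suc n) = (if t = 0 then linf I (V_fam I 1 n) else c0 I (V_fam I 0 n))"

lemma subspace_V_fam: "subspace (V_fam I t n)"
  by (induction n arbitrary: t) (auto simp: subspace_scalars subspace_linf subspace_c0)

lemma V_fam_Suc_between:
  assumes "t \<in> {0, 1}"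
  shows "c0 I (V_fam I (1 - t) n) \<subseteq> V_fam I t (Suc n)" "V_fam I t (Suc n) \<subseteq> linf I (V_fam I (1 - t) n)"
  using assms by (auto simp: c0_subset_linf[THEN subsetD])

lemma V_fam_retract:
  assumes "t \<in> {0, 1}" "j \<in> I"
  shows "contraction (V_fam I (1 - t) n) (V_fam I t (Suc n)) (single j)"
    "contraction (V_fam I t (Suc n)) (V_fam I (1 - t) n) (coord j)"
proof -
  note S = subspace_V_fam[of I "1 - t" n]
  show "contraction (V_fam I (1 - t) n) (V_fam I t (Suc n)) (single j)"
    using contraction_mono[OF contraction_single[OF S] subset_refl] assms(2)
      linf_finite_subset_c0[OF S, of "{j}" I] V_fam_Suc_between(1)[OF assms(1), of I n] by (meson bot_least finite.emptyI finite.insertI insert_subset order_trans)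
  show "contraction (V_fam I t (Suc n)) (V_fam I (1 - t) n) (coord j)"
    by (rule contraction_mono[OF contraction_coord[OF S assms(2)] V_fam_Suc_between(2)[OF assms(1)] subset_refl])
qed

lemma V_fam_nontrivial:
  assumes "I \<noteq> {}" "t \<in> {0, 1}" shows "V_fam I t n \<noteq> {0}"
  using assms(2)
proof (induction n arbitrary: t)
  case 0
  have "(\<lambda>l. if l = [] then 1 else 0) \<in> (scalars :: ('a list \<Rightarrow> 'k) set)" by (simp add: scalars_def)
  moreover have "(\<lambda>l :: 'a list. if l = [] then 1 else 0) \<noteq> (0 :: 'a list \<Rightarrow> 'k)"
    by (auto simp: fun_eq_iff fam_apply)
  ultimately show ?case by auto
next
  case (Suc n)
  obtain j where j: "j \<in> I" using assms(1) by blast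
  obtain u where u: "u \<in> V_fam I (1 - t) n" "u \<noteq> 0"
  proof -
    have "1 - t \<in> {0, 1}" using Suc.prems by auto
    from Suc.IH[OF this] subspaceD(2)[OF subspace_V_fam[of I "1 - t" n]] that show ?thesis by fast
  qed
  have "single j u \<in> V_fam I t (Suc n)" using contractionD(1)[OF V_fam_retract(1)[OF Suc.prems j] u(1)] .
  moreover have "single j u \<noteq> 0" using u(2) by (metis coord_simps(4,5))
  ultimately show ?case by blast
qed

end

context dense_valuation_field
begin

text \<open>Both statements have to be proved together, since the descent exchanges them.\<close>
lemma not_nearly_factors_V_fam:
  assumes I: "infinite I" "\<not> omega1_measurable I"
  shows "\<not> nearly_factors (V_fam I 0 (Suc (n + d))) (V_fam I 1 (Suc n)) \<and>
    \<not> nearly_factors (V_fam I 1 (Suc (n + d))) (V_fam I 0 (Suc n))"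
proof (induction n)
  case 0
  have "I \<noteq> {}" using I by auto
  then show ?case
    using nearly_factors_linf_c0(2)[OF subspace_V_fam[of I 1 d] subspace_V_fam[of I 0 0] I]
      nearly_factors_c0_linf(2)[OF subspace_V_fam[of I 0 d] subspace_V_fam[of I 1 0] I]
      V_fam_nontrivial[of I 0 d] V_fam_nontrivial[of I 1 d] by auto
next
  case (Suc n)
  then show ?case
    using nearly_factors_linf_c0(1)[OF subspace_V_fam[of I 1 "Suc (n + d)"] subspace_V_fam[of I 0 "Suc n"] I]
      nearly_factors_c0_linf(1)[OF subspace_V_fam[of I 0 "Suc (n + d)"] subspace_V_fam[of I 1 "Suc n"] I]
    by (auto simp del: One_nat_def)
qed

lemma V_fam_not_nearly_factors:
  assumes "infinite I" "\<not> omega1_measurable I" "t \<in> {0, 1}" "t' \<in> {0, 1}" "t \<noteq> t'" "0 < n" "n \<le> n'"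
  shows "\<not> nearly_factors (V_fam I t n') (V_fam I t' n)"
proof -
  obtain m where m: "n = Suc m" using \<open>0 < n\<close> gr0_implies_Suc by blast
  obtain d where "n' = n + d" using \<open>n \<le> n'\<close> le_Suc_ex by blast
  then show ?thesis using not_nearly_factors_V_fam[OF assms(1,2), of m d] assms(3-5) m by auto
qed

text \<open>When \<open>t = t'\<close>, the space at level \<open>n'\<close> is replaced by its coordinate space at level \<open>n' - 1 \<ge> n\<close>,
  which is of the other kind.\<close>
lemma V_fam_no_retract:
  assumes I: "infinite I" "\<not> omega1_measurable I" and t: "t \<in> {0, 1}" "t' \<in> {0, 1}"
    and n: "0 < n" "n \<le> n'" "(t, n) \<noteq> (t', n')"
    and f: "contraction (V_fam I t' n') (V_fam I t n) f" and g: "contraction (V_fam I t n) (V_fam I t' n') g"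
    and gf: "\<And>x. x \<in> V_fam I t' n' \<Longrightarrow> g (f x) = x"
  shows False
proof (cases "t = t'")
  case False
  show False
    using V_fam_not_nearly_factors[OF I t(2,1) _ n(1,2)] False nearly_factors_of_retract[OF f g gf] by auto
next
  case True
  then have "n < n'" using n by auto
  then obtain m where m: "n' = Suc m" "n \<le> m" by (cases n') auto
  obtain j where j: "j \<in> I" using I(1) infinite_imp_nonempty by blast
  note r = V_fam_retract[OF t(2) j, of m, folded m(1)]
  have "nearly_factors (V_fam I (1 - t') m) (V_fam I t n)"
  proof (rule nearly_factors_of_retract[OF contraction_comp[OF r(1) f] contraction_comp[OF g r(2)]])
    fix x assume "x \<in> V_fam I (1 - t') m"
    then show "coord j (g (f (single j x))) = x"
      using gf[OF contractionD(1)[OF r(1)]] by simp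
  qed
  moreover have "1 - t' \<in> {0, 1}" "1 - t' \<noteq> t" using t True by auto
  ultimately show False using V_fam_not_nearly_factors[OF I _ t(1) _ n(1) m(2)] by blast
qed

end

section \<open>Comparison with the recursively defined spaces\<close>

primrec flat :: "'i set \<Rightarrow> ('k::zero, 'i) iterated_family \<Rightarrow> 'i list \<Rightarrow> 'k" where
  "flat I (Scalar c) = (\<lambda>l. if l = [] then c else 0)"
| "flat I (Family w) = (\<lambda>l. case l of [] \<Rightarrow> 0 | i # l' \<Rightarrow> if i \<in> I then flat I (w i) l' else 0)"

context complete_valuation_field
begin

lemma flat_nil [simp]: "flat I (Family w) [] = 0"
  by simp

lemma coord_flat [simp]: "coord i (flat I (Family w)) = (if i \<in> I then flat I (w i) else 0)"
  by (auto simp: coord_def fam_apply)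

declare flat.simps(2) [simp del]

text \<open>An isometric linear isomorphism onto a space of functions on sequences.  Closedness of the
  carrier under the operations is included because it is needed to transport linearity back along
  the inverse of \<open>\<phi>\<close>.\<close>
definition represents :: "('k, 'v) normed_space \<Rightarrow> ('i list \<Rightarrow> 'k) set \<Rightarrow> ('v \<Rightarrow> 'i list \<Rightarrow> 'k) \<Rightarrow> bool" where
  "represents V S \<phi> \<longleftrightarrow> bij_betw \<phi> (carrier V) S \<and>
     (\<forall>x\<in>carrier V. \<forall>y\<in>carrier V. add V x y \<in> carrier V \<and> \<phi> (add V x y) = \<phi> x + \<phi> y) \<and>
     (\<forall>a. \<forall>x\<in>carrier V. scale V a x \<in> carrier V \<and> \<phi> (scale V a x) = smult a (\<phi> x)) \<and>
     (\<forall>x\<in>carrier V. nrm V x = supnorm (\<phi> x))"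

lemma representsD:
  assumes "represents V S \<phi>"
  shows "bij_betw \<phi> (carrier V) S" "x \<in> carrier V \<Longrightarrow> \<phi> x \<in> S"
    "x \<in> carrier V \<Longrightarrow> y \<in> carrier V \<Longrightarrow> add V x y \<in> carrier V"
    "x \<in> carrier V \<Longrightarrow> y \<in> carrier V \<Longrightarrow> \<phi> (add V x y) = \<phi> x + \<phi> y"
    "x \<in> carrier V \<Longrightarrow> scale V a x \<in> carrier V" "x \<in> carrier V \<Longrightarrow> \<phi> (scale V a x) = smult a (\<phi> x)"
    "x \<in> carrier V \<Longrightarrow> nrm V x = supnorm (\<phi> x)"
  using assms unfolding represents_def by (auto simp: bij_betw_def)

lemma represents_scalars:
  fixes I :: "'i set"
  shows "represents (V_space v I t 0) scalars (flat I)"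
proof -
  have inv: "inv Scalar (Scalar c) = c" for c :: 'k by (rule inv_f_f) (simp add: inj_def)
  have bij: "bij_betw (flat I) (range Scalar) scalars"
  proof (rule bij_betwI')
    show "(flat I x = flat I y) = (x = y)" if "x \<in> range Scalar" "y \<in> range Scalar" for x y :: "('k, 'i) iterated_family"
      using that by (auto dest: fun_cong[of _ _ "[]"])
    show "flat I x \<in> scalars" if "x \<in> range Scalar" for x :: "('k, 'i) iterated_family"
      using that by (auto simp: scalars_def)
    show "\<exists>x\<in>range Scalar. y = flat I x" if "y \<in> scalars" for y
      using that by (intro bexI[of _ "Scalar (y [])"]) (auto simp: scalars_def)
  qed
  have "supnorm (\<lambda>l :: 'i list. if l = [] then c else 0) = v c" for c
    unfolding supnorm_def by (rule cSup_eq_maximum) (auto intro: rev_image_eqI[of "[]"] nonneg)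
  then show ?thesis
    unfolding represents_def using bij
    by (auto simp: transport_def scalar_space_def inv smult_def fam_apply fun_eq_iff)
qed

text \<open>This covers both kinds of families: the carrier \<open>C\<close> consists of the bounded families or of the
  null families, and \<open>X\<close> is the corresponding space of functions on sequences.\<close>
lemma represents_Family:
  assumes V: "represents V S (flat I)" and S: "subspace S" and I: "I \<noteq> {}"
    and X: "subspace X" "X \<subseteq> linf I S"
    and C: "C \<subseteq> carrier (ell_inf I V)" "\<And>w. w \<in> carrier (ell_inf I V) \<Longrightarrow> w \<in> C \<longleftrightarrow> flat I (Family w) \<in> X"
  shows "represents (transport Family ((ell_inf I V)\<lparr>carrier := C\<rparr>)) X (flat I)"
proof -
  have inv: "inv Family (Family w) = w" for w :: "'b \<Rightarrow> ('k, 'b) iterated_family"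
    by (rule inv_f_f) (simp add: inj_def)
  have wI: "w i \<in> carrier V" if "w \<in> carrier (ell_inf I V)" "i \<in> I" for w i
    using that by (auto simp: ell_inf_def)
  have fl: "flat I (w i) \<in> S" if "w \<in> carrier (ell_inf I V)" "i \<in> I" for w i
    using representsD(2)[OF V wI[OF that]] .
  have norm: "nrm V (w i) = supnorm (flat I (w i))" if "w \<in> carrier (ell_inf I V)" "i \<in> I" for w i
    using representsD(7)[OF V wI[OF that]] .
  have bdd: "bdd_above ((\<lambda>i. supnorm (flat I (w i))) ` I)" if "w \<in> carrier (ell_inf I V)" for w
  proof -
    have "(\<lambda>i. supnorm (flat I (w i))) ` I = (\<lambda>i. nrm V (w i)) ` I" using norm[OF that] by (intro image_cong) auto
    then show ?thesis using that by (auto simp: ell_inf_def)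
  qed
  have supnorm_flat: "bounded_fam (flat I (Family w))" "supnorm (flat I (Family w)) = nrm (ell_inf I V) w"
    if w: "w \<in> carrier (ell_inf I V)" for w
  proof -
    obtain i0 where i0: "i0 \<in> I" using I by blast
    have up: "supnorm (flat I (w i)) \<le> (SUP i\<in>I. supnorm (flat I (w i)))" if "i \<in> I" for i
      by (rule cSUP_upper[OF that bdd[OF w]])
    have 0: "0 \<le> (SUP i\<in>I. supnorm (flat I (w i)))"
      using up[OF i0] supnorm_nonneg[OF subspaceD(1)[OF S fl[OF w i0]]] by linarith
    have b: "bounded_fam (coord i (flat I (Family w)))" for i
      using subspaceD(1)[OF S fl[OF w]] by simp
    have le: "supnorm (coord i (flat I (Family w))) \<le> (SUP i\<in>I. supnorm (flat I (w i)))" for i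
      using up 0 by simp
    show bf: "bounded_fam (flat I (Family w))" by (rule bounded_supnorm_le_coord(1)[OF flat_nil 0 b le])
    have "(SUP i\<in>I. supnorm (flat I (w i))) \<le> supnorm (flat I (Family w))"
    proof (rule cSUP_least[OF I])
      show "supnorm (flat I (w i)) \<le> supnorm (flat I (Family w))" if "i \<in> I" for i
        using supnorm_coord_le[OF bf, of i] that by simp
    qed
    then have "supnorm (flat I (Family w)) = (SUP i\<in>I. supnorm (flat I (w i)))"
      using bounded_supnorm_le_coord(2)[OF flat_nil 0 b le] by simp
    also have "\<dots> = (SUP i\<in>I. nrm V (w i))" using norm[OF w] by (intro SUP_cong) auto
    finally show "supnorm (flat I (Family w)) = nrm (ell_inf I V) w" by (simp add: ell_inf_def)
  qed
  have supnorm_le: "supnorm (flat I (w i)) \<le> supnorm (flat I (Family w))" if "w \<in> carrier (ell_inf I V)" "i \<in> I" for w i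
    using supnorm_coord_le[OF supnorm_flat(1)[OF that(1)], of i] that by simp
  have memI: "w \<in> carrier (ell_inf I V)"
    if w: "w \<in> I \<rightarrow>\<^sub>E carrier V" and B: "\<And>i. i \<in> I \<Longrightarrow> supnorm (flat I (w i)) \<le> B" for w B
  proof -
    have "nrm V (w i) \<le> B" if "i \<in> I" for i
      using B[OF that] representsD(7)[OF V PiE_mem[OF w that]] by simp
    then have "bdd_above ((\<lambda>i. nrm V (w i)) ` I)" by (rule bdd_aboveI2)
    then show ?thesis using w by (simp add: ell_inf_def)
  qed
  have add: "add (ell_inf I V) w w' \<in> C \<and>
      flat I (Family (add (ell_inf I V) w w')) = flat I (Family w) + flat I (Family w')"
    if "w \<in> C" "w' \<in> C" for w w'
  proof -
    have w: "w \<in> carrier (ell_inf I V)" "w' \<in> carrier (ell_inf I V)" using that C by auto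
    define u where "u = add (ell_inf I V) w w'"
    have ui: "u i = add V (w i) (w' i)" if "i \<in> I" for i using that by (simp add: u_def ell_inf_def)
    have fu: "flat I (u i) = flat I (w i) + flat I (w' i)" if "i \<in> I" for i
      using representsD(4)[OF V wI[OF w(1) that] wI[OF w(2) that]] ui[OF that] by simp
    have eq: "flat I (Family u) = flat I (Family w) + flat I (Family w')"
      by (rule fam_eqI) (use fu in \<open>auto simp: fam_apply\<close>)
    have "u \<in> carrier (ell_inf I V)"
    proof (rule memI)
      show "u \<in> I \<rightarrow>\<^sub>E carrier V"
        using representsD(3)[OF V wI[OF w(1)] wI[OF w(2)]] unfolding u_def by (auto simp: ell_inf_def)
      show "supnorm (flat I (u i)) \<le> max (supnorm (flat I (Family w))) (supnorm (flat I (Family w')))" if "i \<in> I" for i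
        unfolding fu[OF that]
        using supnorm_add_le[OF subspaceD(1)[OF S fl[OF w(1) that]] subspaceD(1)[OF S fl[OF w(2) that]]]
          supnorm_le[OF w(1) that] supnorm_le[OF w(2) that] by simp
    qed
    moreover have "flat I (Family u) \<in> X"
      unfolding eq using that C(2) w subspaceD(3)[OF X(1)] by blast
    ultimately show ?thesis using C(2) eq by (simp add: u_def)
  qed
  have scale: "scale (ell_inf I V) a w \<in> C \<and> flat I (Family (scale (ell_inf I V) a w)) = smult a (flat I (Family w))"
    if "w \<in> C" for a w
  proof -
    have w: "w \<in> carrier (ell_inf I V)" using that C by auto
    define u where "u = scale (ell_inf I V) a w"
    have ui: "u i = scale V a (w i)" if "i \<in> I" for i using that by (simp add: u_def ell_inf_def)
    have fu: "flat I (u i) = smult a (flat I (w i))" if "i \<in> I" for i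
      using representsD(6)[OF V wI[OF w that]] ui[OF that] by simp
    have eq: "flat I (Family u) = smult a (flat I (Family w))"
      by (rule fam_eqI) (use fu in auto)
    have "u \<in> carrier (ell_inf I V)"
    proof (rule memI)
      show "u \<in> I \<rightarrow>\<^sub>E carrier V"
        using representsD(5)[OF V wI[OF w]] unfolding u_def by (auto simp: ell_inf_def)
      show "supnorm (flat I (u i)) \<le> v a * supnorm (flat I (Family w))" if "i \<in> I" for i
        unfolding fu[OF that] supnorm_smult[OF subspaceD(1)[OF S fl[OF w that]]]
        using supnorm_le[OF w that] nonneg by (intro mult_left_mono)
    qed
    moreover have "flat I (Family u) \<in> X"
      unfolding eq using that C(2)[OF w] subspaceD(4)[OF X(1)] by blast
    ultimately show ?thesis using C(2) eq by (simp add: u_def)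
  qed
  have bij: "bij_betw (flat I) (Family ` C) X"
  proof (rule bij_betwI')
    fix x y assume "x \<in> Family ` C" "y \<in> Family ` C"
    then obtain w w' where x: "x = Family w" and y: "y = Family w'" and ww: "w \<in> C" "w' \<in> C" by auto
    have w: "w \<in> carrier (ell_inf I V)" "w' \<in> carrier (ell_inf I V)" using ww C by auto
    have "w = w'" if "flat I x = flat I y"
    proof (rule PiE_ext)
      show "w \<in> I \<rightarrow>\<^sub>E carrier V" "w' \<in> I \<rightarrow>\<^sub>E carrier V" using w by (auto simp: ell_inf_def)
      fix i assume i: "i \<in> I"
      have "flat I (w i) = flat I (w' i)"
        using arg_cong[OF that, of "coord i"] i by (simp add: x y)
      then show "w i = w' i"
        using representsD(1)[OF V] wI[OF w(1) i] wI[OF w(2) i] by (auto simp: bij_betw_def inj_on_def)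
    qed
    then show "(flat I x = flat I y) = (x = y)" by (auto simp: x y)
  next
    fix x assume "x \<in> Family ` C"
    then show "flat I x \<in> X" using C by auto
  next
    fix y assume yX: "y \<in> X"
    then have y: "y \<in> linf I S" using X by blast
    define w where "w = (\<lambda>i\<in>I. inv_into (carrier V) (flat I) (coord i y))"
    have im: "coord i y \<in> flat I ` carrier V" if "i \<in> I" for i
      using representsD(1)[OF V] linfD(3)[OF y that] by (auto simp: bij_betw_def)
    have fw: "flat I (w i) = coord i y" if "i \<in> I" for i
      using f_inv_into_f[OF im[OF that]] that by (simp add: w_def)
    have eq: "flat I (Family w) = y"
      by (rule fam_eqI) (use fw linfD(2,4)[OF y] in auto)
    have "w \<in> carrier (ell_inf I V)"
    proof (rule memI)
      show "w \<in> I \<rightarrow>\<^sub>E carrier V" using inv_into_into[OF im] by (auto simp: w_def)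
      show "supnorm (flat I (w i)) \<le> supnorm y" if "i \<in> I" for i
        using fw[OF that] supnorm_coord_le[OF linfD(1)[OF y]] by simp
    qed
    then have "w \<in> C" using C(2) eq yX by simp
    then show "\<exists>x\<in>Family ` C. y = flat I x" using eq by blast
  qed
  show ?thesis
    unfolding represents_def
  proof (intro conjI ballI allI)
    let ?U = "transport Family ((ell_inf I V)\<lparr>carrier := C\<rparr>)"
    have carrier: "carrier ?U = Family ` C" by (simp add: transport_def)
    show "bij_betw (flat I) (carrier ?U) X" unfolding carrier by (rule bij)
    fix x assume "x \<in> carrier ?U"
    then obtain w where w: "w \<in> C" "x = Family w" unfolding carrier by blast
    show "nrm ?U x = supnorm (flat I x)"
      using supnorm_flat(2)[of w] w C(1) by (simp add: subset_iff transport_def inv)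
    show "scale ?U a x \<in> carrier ?U" "flat I (scale ?U a x) = smult a (flat I x)" for a
      unfolding carrier using scale[OF w(1), of a] by (simp_all add: w(2) transport_def inv)
    fix y assume "y \<in> carrier ?U"
    then obtain w' where w': "w' \<in> C" "y = Family w'" unfolding carrier by blast
    show "add ?U x y \<in> carrier ?U" "flat I (add ?U x y) = flat I x + flat I y"
      unfolding carrier using add[OF w(1) w'(1)] by (simp_all add: w(2) w'(2) transport_def inv)
  qed
qed

lemma represents_V_space:
  assumes I: "I \<noteq> {}"
  shows "represents (V_space v I t n) (V_fam I t n) (flat I)"
proof (induction n arbitrary: t)
  case 0
  show ?case using represents_scalars by simp
next
  case (Suc n)
  have fam: "flat I (Family w) \<in> linf I (V_fam I s n)" if w: "w \<in> carrier (ell_inf I (V_space v I s n))" for w s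
  proof -
    let ?V = "V_space v I s n"
    have wI: "w i \<in> carrier ?V" if "i \<in> I" for i using w that by (auto simp: ell_inf_def)
    have fl: "flat I (w i) \<in> V_fam I s n" if "i \<in> I" for i using representsD(2)[OF Suc.IH wI[OF that]] .
    obtain B where B: "\<And>i. i \<in> I \<Longrightarrow> nrm ?V (w i) \<le> B"
      using w by (auto simp: ell_inf_def bdd_above_def)
    have le: "supnorm (coord i (flat I (Family w))) \<le> max B 0" for i
      using B[of i] representsD(7)[OF Suc.IH wI[of i]] by (cases "i \<in> I") auto
    have b: "bounded_fam (coord i (flat I (Family w)))" for i
      using subspaceD(1)[OF subspace_V_fam fl[of i]] by (cases "i \<in> I") auto
    have "bounded_fam (flat I (Family w))"
      by (rule bounded_supnorm_le_coord(1)[OF flat_nil _ b le]) simp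
    then show ?thesis using fl by (auto simp: linf_def)
  qed
  show ?case
  proof (cases "t = 0")
    case True
    have "represents (transport Family ((ell_inf I (V_space v I 1 n))\<lparr>carrier := carrier (ell_inf I (V_space v I 1 n))\<rparr>))
        (linf I (V_fam I 1 n)) (flat I)"
      by (rule represents_Family[OF Suc.IH subspace_V_fam I subspace_linf[OF subspace_V_fam] subset_refl subset_refl])
        (use fam in auto)
    then show ?thesis using True by simp
  next
    case False
    let ?V = "V_space v I 0 n"
    have "w \<in> carrier (c_zero I ?V) \<longleftrightarrow> flat I (Family w) \<in> c0 I (V_fam I 0 n)"
      if w: "w \<in> carrier (ell_inf I ?V)" for w
    proof -
      have "nrm ?V (w i) = supnorm (flat I (w i))" if "i \<in> I" for i
        using w that representsD(7)[OF Suc.IH, of "w i" 0] by (auto simp: ell_inf_def)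
      then have "{i\<in>I. \<epsilon> \<le> nrm ?V (w i)} = {i\<in>I. \<epsilon> \<le> supnorm (coord i (flat I (Family w)))}" for \<epsilon>
        by auto
      then show ?thesis using w fam[OF w] by (simp add: c_zero_def c0_def)
    qed
    then have "represents (transport Family ((ell_inf I ?V)\<lparr>carrier := carrier (c_zero I ?V)\<rparr>))
        (c0 I (V_fam I 0 n)) (flat I)"
      by (intro represents_Family[OF Suc.IH subspace_V_fam I subspace_c0[OF subspace_V_fam] c0_subset_linf])
        (auto simp: c_zero_def)
    then show ?thesis using False by (simp add: c_zero_def)
  qed
qed

lemma isometric_iso_contractions:
  assumes V: "represents V S \<phi>" and W: "represents W S' \<psi>" and iso: "V \<cong>\<^sub>B W"
  shows "\<exists>f g. contraction S S' f \<and> contraction S' S g \<and> (\<forall>x\<in>S. g (f x) = x) \<and> (\<forall>y\<in>S'. f (g y) = y)"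
proof -
  obtain h where h: "bij_betw h (carrier V) (carrier W)"
    "\<And>x y. x \<in> carrier V \<Longrightarrow> y \<in> carrier V \<Longrightarrow> h (add V x y) = add W (h x) (h y)"
    "\<And>a x. x \<in> carrier V \<Longrightarrow> h (scale V a x) = scale W a (h x)"
    "\<And>x. x \<in> carrier V \<Longrightarrow> nrm W (h x) = nrm V x"
    using iso unfolding isometrically_isomorphic_def isometric_linear_iso_def by blast
  have hW: "h x \<in> carrier W" if "x \<in> carrier V" for x using h(1) that by (auto simp: bij_betw_def)
  define \<theta> where "\<theta> = (\<lambda>x. \<psi> (h x))"
  have \<theta>: "bij_betw \<theta> (carrier V) S'"
    unfolding \<theta>_def using bij_betw_trans[OF h(1) representsD(1)[OF W]] by (simp add: comp_def)
  define f where "f = (\<lambda>x. \<theta> (inv_into (carrier V) \<phi> x))"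
  define g where "g = (\<lambda>y. \<phi> (inv_into (carrier V) \<theta> y))"
  have f: "f (\<phi> x) = \<theta> x" if "x \<in> carrier V" for x
    using that representsD(1)[OF V] by (simp add: f_def bij_betw_def)
  have g: "g (\<theta> x) = \<phi> x" if "x \<in> carrier V" for x
    using that \<theta> by (simp add: g_def bij_betw_def)
  have S: "\<exists>u\<in>carrier V. x = \<phi> u" if "x \<in> S" for x using representsD(1)[OF V] that by (auto simp: bij_betw_def)
  have S': "\<exists>u\<in>carrier V. x = \<theta> u" if "x \<in> S'" for x using \<theta> that by (auto simp: bij_betw_def)
  have t: "\<theta> x \<in> S'" "supnorm (\<theta> x) = supnorm (\<phi> x)" "\<theta> (scale V a x) = smult a (\<theta> x)" if "x \<in> carrier V" for a x
    using that representsD(2,6)[OF W hW[OF that]] representsD(7)[OF W hW[OF that]] representsD(7)[OF V that] h(3,4)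
    by (simp_all add: \<theta>_def)
  have t2: "\<theta> (add V x y) = \<theta> x + \<theta> y" if "x \<in> carrier V" "y \<in> carrier V" for x y
    using that representsD(4)[OF W hW[OF that(1)] hW[OF that(2)]] h(2) by (simp add: \<theta>_def)
  have "contraction S S' f"
    unfolding contraction_def
  proof (intro conjI ballI allI)
    fix x assume "x \<in> S"
    then obtain u where u: "u \<in> carrier V" "x = \<phi> u" using S by blast
    show "f x \<in> S'" "supnorm (f x) \<le> supnorm x" using u t f by simp_all
    show "f (smult a x) = smult a (f x)" for a
      using u t f[of "scale V a u"] f[of u] representsD(5,6)[OF V u(1), of a] by simp
    fix y assume "y \<in> S"
    then obtain w where w: "w \<in> carrier V" "y = \<phi> w" using S by blast
    show "f (x + y) = f x + f y"
      using u w t2[OF u(1) w(1)] f[of "add V u w"] f[of u] f[of w] representsD(3,4)[OF V u(1) w(1)] by simp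
  qed
  moreover have "contraction S' S g"
    unfolding contraction_def
  proof (intro conjI ballI allI)
    fix x assume "x \<in> S'"
    then obtain u where u: "u \<in> carrier V" "x = \<theta> u" using S' by blast
    show "g x \<in> S" "supnorm (g x) \<le> supnorm x" using u t g representsD(2)[OF V] by simp_all
    show "g (smult a x) = smult a (g x)" for a
      using u t(3)[OF u(1), of a] g[of "scale V a u"] g[of u] representsD(5,6)[OF V u(1), of a] by simp
    fix y assume "y \<in> S'"
    then obtain w where w: "w \<in> carrier V" "y = \<theta> w" using S' by blast
    show "g (x + y) = g x + g y"
      using u w t2[OF u(1) w(1)] g[of "add V u w"] g[of u] g[of w] representsD(3,4)[OF V u(1) w(1)] by simp
  qed
  moreover have "\<forall>x\<in>S. g (f x) = x" using S f g by fastforce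
  moreover have "\<forall>y\<in>S'. f (g y) = y" using S' f g by fastforce
  ultimately show ?thesis by blast
qed

end

theorem corollary5p12:
  fixes v :: "'k::field \<Rightarrow> real"
    and \<kappa> :: "'i cardinal_or_Ord"
    and lam :: "'i rel"
    and t n t' n' :: nat
  assumes "complete_valuation_field v"
    and "{0..} \<subseteq> closure (range v)"
    and "is_infinite_cardinal_or_Ord \<kappa>"
    and "nonmeasurability_condition \<kappa>"
    and "Card_order lam" and "infinite (Field lam)" and "ordinal_in lam \<kappa>"
    and "(t, n) \<in> {0, 1} \<times> {0<..}"
    and "(t', n') \<in> {0, 1} \<times> {0<..}"
  shows "V_space v (Field lam) t n \<cong>\<^sub>B V_space v (Field lam) t' n' \<longleftrightarrow> (t, n) = (t', n')"
proof
  interpret dense_valuation_field v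
    using assms(1,2) by (simp add: dense_valuation_field_def dense_valuation_field_axioms_def)
  define I where "I = Field lam"
  have I: "infinite I" "\<not> omega1_measurable I"
    using assms(4,6,7) by (auto simp: I_def nonmeasurability_condition_def)
  then have "I \<noteq> {}" by auto
  assume "V_space v (Field lam) t n \<cong>\<^sub>B V_space v (Field lam) t' n'"
  then have iso: "V_space v I t n \<cong>\<^sub>B V_space v I t' n'" by (simp only: I_def)
  from isometric_iso_contractions[OF represents_V_space[OF \<open>I \<noteq> {}\<close>] represents_V_space[OF \<open>I \<noteq> {}\<close>] this]
  obtain f g where fg: "contraction (V_fam I t n) (V_fam I t' n') f" "contraction (V_fam I t' n') (V_fam I t n) g"
    and inverse: "\<forall>x\<in>V_fam I t n. g (f x) = x" "\<forall>y\<in>V_fam I t' n'. f (g y) = y"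
    by (elim exE conjE)
  have t: "t \<in> {0, 1}" "t' \<in> {0, 1}" "0 < n" "0 < n'" using assms(8,9) by auto
  show "(t, n) = (t', n')"
  proof (rule ccontr)
    assume ne: "(t, n) \<noteq> (t', n')"
    consider "n \<le> n'" | "n' \<le> n" by linarith
    then show False
    proof cases
      case 1
      show False by (rule V_fam_no_retract[OF I t(1,2,3) 1 ne fg(2,1) bspec[OF inverse(2)]])
    next
      case 2
      show False by (rule V_fam_no_retract[OF I t(2,1,4) 2 ne[symmetric] fg bspec[OF inverse(1)]])
    qed
  qed
next
  assume "(t, n) = (t', n')"
  then show "V_space v (Field lam) t n \<cong>\<^sub>B V_space v (Field lam) t' n'"
    unfolding isometrically_isomorphic_def isometric_linear_iso_def by (intro exI[of _ id]) simp
qed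

end
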